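(* Let $M\subseteq\mathbb{D}^d$ be a fixed constructible set, let $(X,d)$ be either $(\mathbb{I},d_2)$ or $(\Theta,d_g)$, and let $A\subseteq\mathbb{S}^{d-1}$ be a subset of directions. Then for every degree $n$ the PHT interleaving distance between $\mathrm{PHT}^X_n(M)$ and its Kan extension approximation $\overline{\mathrm{PHT}}^X_n(M)$ from $A$ (left, right, or center) satisfies $$d_I\bigl(\mathrm{PHT}^X_n(M),\overline{\mathrm{PHT}}^X_n(M)\bigr)\le 2\,d_H(A,\mathbb{S}^{d-1}),$$ where $d_H$ is the Hausdorff distance with respect to the metric $d$ on $\mathbb{S}^{d-1}$.
   Context: Fix a field $\Bbbk$; $\mathrm{Vect}$ is the category of $\Bbbk$-vector spaces and $H_n$ is homology with coefficients in $\Bbbk$. Fix an o-minimal structure $\mathcal{O}=\{\mathcal{O}_d\}$: for each $d\ge 0$ a boolean algebra $\mathcal{O}_d$ of subsets of $\mathbb{R}^d$, with $\mathcal{O}_1$ consisting only of finite unions of points and intervals, closed under $A\mapsto A\times\mathbb{R},\ \mathbb{R}\times A$ and under axis-aligned projections $\mathbb{R}^{d+1}\to\mathbb{R}^d$, and containing all semialgebraic sets. A constructible set is a compact member of some $\mathcal{O}_d$. $\mathbb{D}^d$ is the closed unit ball in $\mathbb{R}^d$, $\mathbb{S}^{d-1}$ the unit sphere. For $v\in\mathbb{S}^{d-1}$, $t\in\mathbb{R}$, put $M_{v,t}=\{x\in M: x\cdot v\le t\}$. $\mathbb{I}=[-1,1]$, $\Theta=[-\pi,0]$; $d_2(v,w)=\|v-w\|_2$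 and $d_g(v,w)=\arccos(v\cdot w)$ on $\mathbb{S}^{d-1}$. Since $A\subseteq\mathbb{S}^{d-1}$, $d_H(A,\mathbb{S}^{d-1})=\sup_{w\in\mathbb{S}^{d-1}}\inf_{v\in A}d(v,w)$ (with $\inf\emptyset=+\infty$). The interval $X$ is viewed as a category via $\le$, and $\mathrm{Vect}^X$ is the category of functors $X\to\mathrm{Vect}$ ($X$-persistence modules). The persistent homology transform $\mathrm{PHT}^X_n(M):\mathbb{S}^{d-1}\to\mathrm{Vect}^X$ is given by $\mathrm{PHT}^{\mathbb{I}}_n(M)(v)(t)=H_n(M_{v,t})$ and $\mathrm{PHT}^{\Theta}_n(M)(v)(\theta)=H_n(M_{v,\cos\theta})$, with maps induced by inclusions. Interleaving distance: for $\varepsilon\ge0$ let $T_\varepsilon:X\to X$, $T_\varepsilon(x)=\min(x+\varepsilon,\sup X)$. An $\varepsilon$-interleaving between $U,V\in\mathrm{Vect}^X$ is a pair of natural transformations $\Phi:U\Rightarrow VT_\varepsilon$, $\Psi:V\Rightarrow UT_\varepsilon$ with $(\Psi T_\varepsilon)\Phi=U\sigma_{2\varepsilon}$ and $(\Phi T_\varepsilon)\Psi=V\sigma_{2\varepsilon}$, where $\sigma_{2\varepsilon}:\mathrm{Id}\Rightarrow T_{2\varepsilon}$ is the canonical natural transformation. $d_{\mathrm{Int}}(U,V)$ is the infimum of the $\varepsilon\ge0$ for which an $\varepsilon$-interleaving exists ($\infty$ if none). For maps $F,F':\mathbb{S}^{d-1}\to\mathrm{Vect}^X$, the PHT interleaving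 distance is $d_I(F,F')=\sup_{v\in\mathbb{S}^{d-1}}d_{\mathrm{Int}}(F(v),F'(v))$. Space-time category: $\mathbb{AX}$ is the pre-order category with object set $A\times X$ and a unique morphism $(v,\alpha)\to(w,\beta)$ exactly when $\alpha+d(v,w)\le\beta$ or $\beta=\sup X$. Whenever such a morphism exists, the sublevel set of $M$ at $(v,\alpha)$ is contained in that at $(w,\beta)$, so $G(v,\alpha)=\mathrm{PHT}^X_n(M)(v)(\alpha)$ with inclusion-induced maps is a functor $G:\mathbb{AX}\to\mathrm{Vect}$. $\mathbb{S}^{d-1}\mathbb{X}$ is this category for $A=\mathbb{S}^{d-1}$. Kan extensions: for $(w,\beta)\in\mathbb{S}^{d-1}\mathbb{X}$, the left Kan extension is $\mathrm{Lan}(w,\beta)=\operatorname{colim} G(v,\alpha)$ over the full subcategory of $(v,\alpha)\in\mathbb{AX}$ admitting a morphism $(v,\alpha)\to(w,\beta)$; the right Kan extension is $\mathrm{Ran}(w,\beta)=\lim G(v,\alpha)$ over the full subcategory of $(v,\alpha)\in\mathbb{AX}$ admitting a morphism $(w,\beta)\to(v,\alpha)$; the center Kan extension assigns to $(w,\beta)$ the image of the canonical map $\mathrm{Lan}(w,\beta)\to\mathrm{Ran}(w,\beta)$ (induced by the universal properties from the maps of $G$ on composites $(v,\alpha)\to(w,\beta)\to(v',\alpha')$). For any one of these choices $\hat G$, $\overline{\mathrm{PHT}}^X_n(M)(w)=\hat G(w,\cdot)$. *)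

theory Defs
  imports "HOL-Analysis.Analysis" "HOL-Homology.Homology" "HOL-Algebra.Module"
begin

section \<open>Euclidean geometry\<close>

text \<open>Since an o-minimal structure relates the spaces \<open>\<real>\<^sup>d\<close> for different \<open>d\<close>, the space \<open>\<real>\<^sup>d\<close> is the
  library's \<open>Euclidean_space d\<close>: the functions \<open>nat \<Rightarrow> real\<close> that vanish from index \<open>d\<close> on. This
  includes \<open>d = 0\<close>, where the unit sphere is empty.\<close>

abbreviation Rd :: "nat \<Rightarrow> (nat \<Rightarrow> real) set" where
  "Rd d \<equiv> topspace (Euclidean_space d)"

definition dot :: "nat \<Rightarrow> (nat \<Rightarrow> real) \<Rightarrow> (nat \<Rightarrow> real) \<Rightarrow> real" where
  "dot d x y = (\<Sum>i<d. x i * y i)"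

definition unit_disk :: "nat \<Rightarrow> (nat \<Rightarrow> real) set" where
  "unit_disk d = {x \<in> Rd d. L2_set x {..<d} \<le> 1}"

definition unit_sphere :: "nat \<Rightarrow> (nat \<Rightarrow> real) set" where
  "unit_sphere d = {x \<in> Rd d. L2_set x {..<d} = 1}"

definition chordal_dist :: "nat \<Rightarrow> (nat \<Rightarrow> real) \<Rightarrow> (nat \<Rightarrow> real) \<Rightarrow> real" where
  "chordal_dist d v w = L2_set (\<lambda>i. v i - w i) {..<d}"

definition geodesic_dist :: "nat \<Rightarrow> (nat \<Rightarrow> real) \<Rightarrow> (nat \<Rightarrow> real) \<Rightarrow> real" where
  "geodesic_dist d v w = arccos (dot d v w)"


section \<open>O-minimal structures and constructible sets\<close>

inductive polynomial_fun :: "nat \<Rightarrow> ((nat \<Rightarrow> real) \<Rightarrow> real) \<Rightarrow> bool" for d where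
  const: "polynomial_fun d (\<lambda>x. c)"
| coord: "i < d \<Longrightarrow> polynomial_fun d (\<lambda>x. x i)"
| add: "polynomial_fun d p \<Longrightarrow> polynomial_fun d q \<Longrightarrow> polynomial_fun d (\<lambda>x. p x + q x)"
| mult: "polynomial_fun d p \<Longrightarrow> polynomial_fun d q \<Longrightarrow> polynomial_fun d (\<lambda>x. p x * q x)"

inductive semialgebraic :: "nat \<Rightarrow> (nat \<Rightarrow> real) set \<Rightarrow> bool" for d where
  eq: "polynomial_fun d p \<Longrightarrow> semialgebraic d {x \<in> Rd d. p x = 0}"
| pos: "polynomial_fun d p \<Longrightarrow> semialgebraic d {x \<in> Rd d. p x > 0}"
| compl: "semialgebraic d A \<Longrightarrow> semialgebraic d (Rd d - A)"
| union: "semialgebraic d A \<Longrightarrow> semialgebraic d B \<Longrightarrow> semialgebraic d (A \<union> B)"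

definition drop_coord :: "nat \<Rightarrow> (nat \<Rightarrow> real) \<Rightarrow> nat \<Rightarrow> real" where
  "drop_coord k x = (\<lambda>i. if i < k then x i else x (Suc i))"

text \<open>In \<open>tame_1\<close>, \<open>\<real>\<^sup>1\<close> is identified with \<open>\<real>\<close> through the coordinate \<open>x 0\<close>; points count as
  degenerate intervals.\<close>

locale o_minimal_structure =
  fixes \<O> :: "nat \<Rightarrow> (nat \<Rightarrow> real) set set"
  assumes boolean: "Sigma_Algebra.algebra (Rd d) (\<O> d)"
    and tame_1: "A \<in> \<O> 1 \<Longrightarrow>
      \<exists>F. finite F \<and> (\<forall>I\<in>F. is_interval I) \<and> (\<lambda>x. x 0) ` A = (\<Union>F :: real set)"
    and times_R: "A \<in> \<O> d \<Longrightarrow> {x \<in> Rd (Suc d). x(d := 0) \<in> A} \<in> \<O> (Suc d)"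
    and R_times: "A \<in> \<O> d \<Longrightarrow> {x \<in> Rd (Suc d). (\<lambda>i. x (Suc i)) \<in> A} \<in> \<O> (Suc d)"
    and projection: "A \<in> \<O> (Suc d) \<Longrightarrow> k \<le> d \<Longrightarrow> drop_coord k ` A \<in> \<O> d"
    and semialgebraic: "semialgebraic d A \<Longrightarrow> A \<in> \<O> d"

definition constructible :: "(nat \<Rightarrow> (nat \<Rightarrow> real) set set) \<Rightarrow> nat \<Rightarrow> (nat \<Rightarrow> real) set \<Rightarrow> bool" where
  "constructible \<O> d M \<longleftrightarrow> compactin (Euclidean_space d) M \<and> M \<in> \<O> d"


section \<open>Vector spaces\<close>

text \<open>Vector spaces over a field \<open>k\<close> are the modules over \<open>k\<close> of \<open>HOL-Algebra\<close>; the multiplicative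
  fields of the module record are irrelevant.\<close>

definition linear_map ::
    "('k, 'r) ring_scheme \<Rightarrow> ('k, 'b) module \<Rightarrow> ('k, 'c) module \<Rightarrow> ('b \<Rightarrow> 'c) \<Rightarrow> bool" where
  "linear_map k V W f \<longleftrightarrow> f \<in> carrier V \<rightarrow> carrier W \<and>
     (\<forall>x\<in>carrier V. \<forall>y\<in>carrier V. f (x \<oplus>\<^bsub>V\<^esub> y) = f x \<oplus>\<^bsub>W\<^esub> f y) \<and>
     (\<forall>a\<in>carrier k. \<forall>x\<in>carrier V. f (a \<odot>\<^bsub>V\<^esub> x) = a \<odot>\<^bsub>W\<^esub> f x)"

definition quotient_module :: "('k, 'b) module \<Rightarrow> 'b set \<Rightarrow> ('k, 'b set) module" where
  "quotient_module V N = \<lparr>carrier = a_rcosets\<^bsub>V\<^esub> N, mult = undefined, one = undefined,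
     zero = N, add = set_add V, smult = (\<lambda>a X. \<Union>x\<in>X. N +>\<^bsub>V\<^esub> (a \<odot>\<^bsub>V\<^esub> x))\<rparr>"

definition product_module :: "'i set \<Rightarrow> ('i \<Rightarrow> ('k, 'b) module) \<Rightarrow> ('k, 'i \<Rightarrow> 'b) module" where
  "product_module J V = \<lparr>carrier = (\<Pi>\<^sub>E j\<in>J. carrier (V j)), mult = undefined, one = undefined,
     zero = (\<lambda>j\<in>J. \<zero>\<^bsub>V j\<^esub>), add = (\<lambda>f g. \<lambda>j\<in>J. f j \<oplus>\<^bsub>V j\<^esub> g j),
     smult = (\<lambda>a f. \<lambda>j\<in>J. a \<odot>\<^bsub>V j\<^esub> f j)\<rparr>"

definition direct_sum_module :: "'i set \<Rightarrow> ('i \<Rightarrow> ('k, 'b) module) \<Rightarrow> ('k, 'i \<Rightarrow> 'b) module" where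
  "direct_sum_module J V = (product_module J V)
     \<lparr>carrier := {f \<in> carrier (product_module J V). finite {j\<in>J. f j \<noteq> \<zero>\<^bsub>V j\<^esub>}}\<rparr>"


section \<open>Singular homology with coefficients in a field\<close>

text \<open>A \<open>p\<close>-chain of \<open>X\<close> is its coefficient function, which is zero outside finitely many singular
  simplices of \<open>X\<close>. Hence the chains of a subspace literally are chains of the whole space.\<close>

definition chain_module ::
    "('k, 'r) ring_scheme \<Rightarrow> nat \<Rightarrow> 'a topology \<Rightarrow> ('k, ((nat \<Rightarrow> real) \<Rightarrow> 'a) \<Rightarrow> 'k) module" where
  "chain_module k p X =
     \<lparr>carrier = {c. (\<forall>\<sigma>. c \<sigma> \<in> carrier k) \<and> finite {\<sigma>. c \<sigma> \<noteq> \<zero>\<^bsub>k\<^esub>} \<and>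
                    {\<sigma>. c \<sigma> \<noteq> \<zero>\<^bsub>k\<^esub>} \<subseteq> singular_simplex_set p X},
      mult = undefined, one = undefined,
      zero = (\<lambda>\<sigma>. \<zero>\<^bsub>k\<^esub>), add = (\<lambda>b c \<sigma>. b \<sigma> \<oplus>\<^bsub>k\<^esub> c \<sigma>), smult = (\<lambda>a c \<sigma>. a \<otimes>\<^bsub>k\<^esub> c \<sigma>)\<rparr>"

text \<open>The coefficient at \<open>\<tau>\<close> of \<open>\<Sum>\<^sub>\<sigma> c \<sigma> \<Sum>\<^sub>i (-1)\<^sup>i \<sigma> \<circ> \<delta>\<^sub>i\<close>.\<close>

definition boundary_map :: "('k, 'r) ring_scheme \<Rightarrow> nat \<Rightarrow>
    (((nat \<Rightarrow> real) \<Rightarrow> 'a) \<Rightarrow> 'k) \<Rightarrow> ((nat \<Rightarrow> real) \<Rightarrow> 'a) \<Rightarrow> 'k" where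
  "boundary_map k p c = (\<lambda>\<tau>. if p = 0 then \<zero>\<^bsub>k\<^esub> else
     finsum k (\<lambda>(\<sigma>, i). ((\<ominus>\<^bsub>k\<^esub> \<one>\<^bsub>k\<^esub>) [^]\<^bsub>k\<^esub> i) \<otimes>\<^bsub>k\<^esub> c \<sigma>)
       {(\<sigma>, i). c \<sigma> \<noteq> \<zero>\<^bsub>k\<^esub> \<and> i \<le> p \<and> singular_face p i \<sigma> = \<tau>})"

definition cycles ::
    "('k, 'r) ring_scheme \<Rightarrow> nat \<Rightarrow> 'a topology \<Rightarrow> (((nat \<Rightarrow> real) \<Rightarrow> 'a) \<Rightarrow> 'k) set" where
  "cycles k p X = {c \<in> carrier (chain_module k p X). boundary_map k p c = (\<lambda>\<tau>. \<zero>\<^bsub>k\<^esub>)}"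

definition boundaries ::
    "('k, 'r) ring_scheme \<Rightarrow> nat \<Rightarrow> 'a topology \<Rightarrow> (((nat \<Rightarrow> real) \<Rightarrow> 'a) \<Rightarrow> 'k) set" where
  "boundaries k p X = boundary_map k (Suc p) ` carrier (chain_module k (Suc p) X)"

definition homology_module ::
    "('k, 'r) ring_scheme \<Rightarrow> nat \<Rightarrow> 'a topology \<Rightarrow> ('k, (((nat \<Rightarrow> real) \<Rightarrow> 'a) \<Rightarrow> 'k) set) module" where
  "homology_module k p X =
     quotient_module ((chain_module k p X)\<lparr>carrier := cycles k p X\<rparr>) (boundaries k p X)"

text \<open>The map \<open>H\<^sub>p(S) \<rightarrow> H\<^sub>p(X)\<close> induced by the inclusion of a subspace \<open>S\<close> of \<open>X\<close>: the class of a
  cycle \<open>c\<close> of \<open>S\<close> goes to the class of \<open>c\<close> in \<open>X\<close>. Only the target space is an argument.\<close>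

definition homology_inclusion :: "('k, 'r) ring_scheme \<Rightarrow> nat \<Rightarrow> 'a topology \<Rightarrow>
    (((nat \<Rightarrow> real) \<Rightarrow> 'a) \<Rightarrow> 'k) set \<Rightarrow> (((nat \<Rightarrow> real) \<Rightarrow> 'a) \<Rightarrow> 'k) set" where
  "homology_inclusion k p X C = (\<Union>c\<in>C. boundaries k p X +>\<^bsub>chain_module k p X\<^esub> c)"


section \<open>Diagrams of vector spaces on a pre-order\<close>

text \<open>A functor from a pre-order to vector spaces: \<open>arr G i j\<close> is the value of \<open>G\<close> on the unique
  morphism from \<open>i\<close> to \<open>j\<close> and is meaningful only if that morphism exists.\<close>

record ('i, 'k, 'b) diagram =
  obj :: "'i \<Rightarrow> ('k, 'b) module"
  arr :: "'i \<Rightarrow> 'i \<Rightarrow> 'b \<Rightarrow> 'b"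


section \<open>Colimits and limits\<close>

text \<open>The colimit is the direct sum modulo the submodule generated by the elements
  \<open>\<iota>\<^sub>i(x) - \<iota>\<^sub>j(G(i \<rightarrow> j)(x))\<close>; the limit is the submodule of compatible families of the product.\<close>

definition summand_inj :: "'i set \<Rightarrow> ('i, 'k, 'b) diagram \<Rightarrow> 'i \<Rightarrow> 'b \<Rightarrow> 'i \<Rightarrow> 'b" where
  "summand_inj J G j x = (\<lambda>i\<in>J. if i = j then x else \<zero>\<^bsub>obj G i\<^esub>)"

definition colim_relations :: "('k, 'r) ring_scheme \<Rightarrow> 'i set \<Rightarrow> ('i \<Rightarrow> 'i \<Rightarrow> bool) \<Rightarrow>
    ('i, 'k, 'b) diagram \<Rightarrow> ('i \<Rightarrow> 'b) set" where
  "colim_relations k J rel G =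
     (let D = direct_sum_module J (obj G) in
      (\<lambda>N. submodule N k D) hull
        {summand_inj J G i x \<ominus>\<^bsub>D\<^esub> summand_inj J G j (arr G i j x) | i j x.
           i \<in> J \<and> j \<in> J \<and> rel i j \<and> x \<in> carrier (obj G i)})"

definition colimit_module :: "('k, 'r) ring_scheme \<Rightarrow> 'i set \<Rightarrow> ('i \<Rightarrow> 'i \<Rightarrow> bool) \<Rightarrow>
    ('i, 'k, 'b) diagram \<Rightarrow> ('k, ('i \<Rightarrow> 'b) set) module" where
  "colimit_module k J rel G = quotient_module (direct_sum_module J (obj G)) (colim_relations k J rel G)"

definition colim_inj :: "('k, 'r) ring_scheme \<Rightarrow> 'i set \<Rightarrow> ('i \<Rightarrow> 'i \<Rightarrow> bool) \<Rightarrow>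
    ('i, 'k, 'b) diagram \<Rightarrow> 'i \<Rightarrow> 'b \<Rightarrow> ('i \<Rightarrow> 'b) set" where
  "colim_inj k J rel G j x =
     colim_relations k J rel G +>\<^bsub>direct_sum_module J (obj G)\<^esub> summand_inj J G j x"

text \<open>The map out of the colimit induced by a cocone \<open>\<phi>\<^sub>j : G j \<rightarrow> W\<close>; it sends the class of \<open>f\<close> to
  \<open>\<Sum>\<^sub>j \<phi>\<^sub>j(f j)\<close>.\<close>

definition colim_desc :: "'i set \<Rightarrow> ('i, 'k, 'b) diagram \<Rightarrow> ('k, 'c) module \<Rightarrow>
    ('i \<Rightarrow> 'b \<Rightarrow> 'c) \<Rightarrow> ('i \<Rightarrow> 'b) set \<Rightarrow> 'c" where
  "colim_desc J G W \<phi> C =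
     the_elem ((\<lambda>f. \<Oplus>\<^bsub>W\<^esub>j\<in>{j\<in>J. f j \<noteq> \<zero>\<^bsub>obj G j\<^esub>}. \<phi> j (f j)) ` C)"

definition limit_module :: "'i set \<Rightarrow> ('i \<Rightarrow> 'i \<Rightarrow> bool) \<Rightarrow>
    ('i, 'k, 'b) diagram \<Rightarrow> ('k, 'i \<Rightarrow> 'b) module" where
  "limit_module J rel G = (product_module J (obj G))
     \<lparr>carrier := {f \<in> carrier (product_module J (obj G)).
                    \<forall>i\<in>J. \<forall>j\<in>J. rel i j \<longrightarrow> arr G i j (f i) = f j}\<rparr>"

definition lim_lift :: "'i set \<Rightarrow> ('i \<Rightarrow> 'c \<Rightarrow> 'b) \<Rightarrow> 'c \<Rightarrow> 'i \<Rightarrow> 'b" where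
  "lim_lift J \<phi> x = (\<lambda>j\<in>J. \<phi> j x)"


section \<open>Kan extensions along the inclusion of a full sub-pre-order\<close>

definition left_kan :: "('k, 'r) ring_scheme \<Rightarrow> 'i set \<Rightarrow> ('i \<Rightarrow> 'i \<Rightarrow> bool) \<Rightarrow>
    ('i, 'k, 'b) diagram \<Rightarrow> ('i, 'k, ('i \<Rightarrow> 'b) set) diagram" where
  "left_kan k J rel G =
     \<lparr>obj = (\<lambda>p. colimit_module k {j\<in>J. rel j p} rel G),
      arr = (\<lambda>p q. colim_desc {j\<in>J. rel j p} G (colimit_module k {j\<in>J. rel j q} rel G)
                     (colim_inj k {j\<in>J. rel j q} rel G))\<rparr>"

definition right_kan :: "'i set \<Rightarrow> ('i \<Rightarrow> 'i \<Rightarrow> bool) \<Rightarrow>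
    ('i, 'k, 'b) diagram \<Rightarrow> ('i, 'k, 'i \<Rightarrow> 'b) diagram" where
  "right_kan J rel G =
     \<lparr>obj = (\<lambda>p. limit_module {j\<in>J. rel p j} rel G),
      arr = (\<lambda>p q. lim_lift {j\<in>J. rel q j} (\<lambda>j f. f j))\<rparr>"

text \<open>The canonical map from the left to the right Kan extension, induced by the maps
  \<open>G(i \<rightarrow> j)\<close> for \<open>i \<rightarrow> p \<rightarrow> j\<close>; its image is the center Kan extension.\<close>

definition kan_comparison :: "'i set \<Rightarrow> ('i \<Rightarrow> 'i \<Rightarrow> bool) \<Rightarrow>
    ('i, 'k, 'b) diagram \<Rightarrow> 'i \<Rightarrow> ('i \<Rightarrow> 'b) set \<Rightarrow> 'i \<Rightarrow> 'b" where
  "kan_comparison J rel G p =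
     colim_desc {i\<in>J. rel i p} G (limit_module {j\<in>J. rel p j} rel G)
       (\<lambda>i. lim_lift {j\<in>J. rel p j} (\<lambda>j. arr G i j))"

definition center_kan :: "('k, 'r) ring_scheme \<Rightarrow> 'i set \<Rightarrow> ('i \<Rightarrow> 'i \<Rightarrow> bool) \<Rightarrow>
    ('i, 'k, 'b) diagram \<Rightarrow> ('i, 'k, 'i \<Rightarrow> 'b) diagram" where
  "center_kan k J rel G =
     \<lparr>obj = (\<lambda>p. (obj (right_kan J rel G) p)
              \<lparr>carrier := kan_comparison J rel G p ` carrier (obj (left_kan k J rel G) p)\<rparr>),
      arr = arr (right_kan J rel G)\<rparr>"


section \<open>Interleaving distance of persistence modules\<close>

definition time_shift :: "real set \<Rightarrow> real \<Rightarrow> real \<Rightarrow> real" where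
  "time_shift X \<epsilon> x = min (x + \<epsilon>) (Sup X)"

definition shifted :: "real set \<Rightarrow> real \<Rightarrow> (real, 'k, 'b) diagram \<Rightarrow> (real, 'k, 'b) diagram" where
  "shifted X \<epsilon> U = \<lparr>obj = (\<lambda>x. obj U (time_shift X \<epsilon> x)),
                    arr = (\<lambda>x y. arr U (time_shift X \<epsilon> x) (time_shift X \<epsilon> y))\<rparr>"

definition natural_trans :: "('k, 'r) ring_scheme \<Rightarrow> real set \<Rightarrow> (real, 'k, 'b) diagram \<Rightarrow>
    (real, 'k, 'c) diagram \<Rightarrow> (real \<Rightarrow> 'b \<Rightarrow> 'c) \<Rightarrow> bool" where
  "natural_trans k X U V \<Phi> \<longleftrightarrow>
     (\<forall>x\<in>X. linear_map k (obj U x) (obj V x) (\<Phi> x)) \<and>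
     (\<forall>x\<in>X. \<forall>y\<in>X. x \<le> y \<longrightarrow>
        (\<forall>u\<in>carrier (obj U x). \<Phi> y (arr U x y u) = arr V x y (\<Phi> x u)))"

definition interleaving :: "('k, 'r) ring_scheme \<Rightarrow> real set \<Rightarrow> real \<Rightarrow> (real, 'k, 'b) diagram \<Rightarrow>
    (real, 'k, 'c) diagram \<Rightarrow> (real \<Rightarrow> 'b \<Rightarrow> 'c) \<Rightarrow> (real \<Rightarrow> 'c \<Rightarrow> 'b) \<Rightarrow> bool" where
  "interleaving k X \<epsilon> U V \<Phi> \<Psi> \<longleftrightarrow>
     natural_trans k X U (shifted X \<epsilon> V) \<Phi> \<and> natural_trans k X V (shifted X \<epsilon> U) \<Psi> \<and>
     (\<forall>x\<in>X. \<forall>u\<in>carrier (obj U x).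
        \<Psi> (time_shift X \<epsilon> x) (\<Phi> x u) = arr U x (time_shift X (2 * \<epsilon>) x) u) \<and>
     (\<forall>x\<in>X. \<forall>v\<in>carrier (obj V x).
        \<Phi> (time_shift X \<epsilon> x) (\<Psi> x v) = arr V x (time_shift X (2 * \<epsilon>) x) v)"

definition d_Int :: "('k, 'r) ring_scheme \<Rightarrow> real set \<Rightarrow> (real, 'k, 'b) diagram \<Rightarrow>
    (real, 'k, 'c) diagram \<Rightarrow> ennreal" where
  "d_Int k X U V = Inf {ennreal \<epsilon> | \<epsilon>. 0 \<le> \<epsilon> \<and> (\<exists>\<Phi> \<Psi>. interleaving k X \<epsilon> U V \<Phi> \<Psi>)}"


section \<open>The persistent homology transform and its Kan extension approximations\<close>

text \<open>The two choices of \<open>(X, d)\<close>: \<open>Height\<close> is \<open>([-1,1], d\<^sub>2)\<close> and \<open>Angle\<close> is \<open>([-\<pi>,0], d\<^sub>g)\<close>.\<close>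

datatype setting = Height | Angle

fun interval :: "setting \<Rightarrow> real set" where
  "interval Height = {-1..1}"
| "interval Angle = {-pi..0}"

fun threshold :: "setting \<Rightarrow> real \<Rightarrow> real" where
  "threshold Height t = t"
| "threshold Angle \<theta> = cos \<theta>"

fun sphere_dist :: "setting \<Rightarrow> nat \<Rightarrow> (nat \<Rightarrow> real) \<Rightarrow> (nat \<Rightarrow> real) \<Rightarrow> real" where
  "sphere_dist Height d = chordal_dist d"
| "sphere_dist Angle d = geodesic_dist d"

text \<open>The Hausdorff distance between \<open>A \<subseteq> unit_sphere d\<close> and the whole sphere; for \<open>A\<close> contained in
  the sphere, only this one of the two suprema can be non-zero. The infimum over an empty \<open>A\<close>
  is \<open>\<infinity>\<close>.\<close>

definition d_H :: "setting \<Rightarrow> nat \<Rightarrow> (nat \<Rightarrow> real) set \<Rightarrow> ennreal" where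
  "d_H s d A = (SUP w\<in>unit_sphere d. INF v\<in>A. ennreal (sphere_dist s d v w))"

definition d_I :: "('k, 'r) ring_scheme \<Rightarrow> setting \<Rightarrow> nat \<Rightarrow>
    ((nat \<Rightarrow> real) \<Rightarrow> (real, 'k, 'b) diagram) \<Rightarrow> ((nat \<Rightarrow> real) \<Rightarrow> (real, 'k, 'c) diagram) \<Rightarrow> ennreal" where
  "d_I k s d F F' = (SUP v\<in>unit_sphere d. d_Int k (interval s) (F v) (F' v))"

definition sublevel ::
    "setting \<Rightarrow> nat \<Rightarrow> (nat \<Rightarrow> real) set \<Rightarrow> (nat \<Rightarrow> real) \<Rightarrow> real \<Rightarrow> (nat \<Rightarrow> real) topology" where
  "sublevel s d M v t = subtopology (Euclidean_space d) {x\<in>M. dot d x v \<le> threshold s t}"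

type_synonym 'k homology_class = "(((nat \<Rightarrow> real) \<Rightarrow> (nat \<Rightarrow> real)) \<Rightarrow> 'k) set"

definition PHT :: "('k, 'r) ring_scheme \<Rightarrow> setting \<Rightarrow> nat \<Rightarrow> nat \<Rightarrow> (nat \<Rightarrow> real) set \<Rightarrow>
    (nat \<Rightarrow> real) \<Rightarrow> (real, 'k, 'k homology_class) diagram" where
  "PHT k s d n M v =
     \<lparr>obj = (\<lambda>t. homology_module k n (sublevel s d M v t)),
      arr = (\<lambda>t t'. homology_inclusion k n (sublevel s d M v t'))\<rparr>"

text \<open>The morphisms of the space-time category; its objects are \<open>A \<times> interval s\<close>.\<close>

definition spacetime_le ::
    "setting \<Rightarrow> nat \<Rightarrow> (nat \<Rightarrow> real) \<times> real \<Rightarrow> (nat \<Rightarrow> real) \<times> real \<Rightarrow> bool" where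
  "spacetime_le s d = (\<lambda>(v, \<alpha>) (w, \<beta>). \<alpha> + sphere_dist s d v w \<le> \<beta> \<or> \<beta> = Sup (interval s))"

definition spacetime_diagram :: "('k, 'r) ring_scheme \<Rightarrow> setting \<Rightarrow> nat \<Rightarrow> nat \<Rightarrow> (nat \<Rightarrow> real) set \<Rightarrow>
    ((nat \<Rightarrow> real) \<times> real, 'k, 'k homology_class) diagram" where
  "spacetime_diagram k s d n M =
     \<lparr>obj = (\<lambda>(v, \<alpha>). obj (PHT k s d n M v) \<alpha>),
      arr = (\<lambda>_ (w, \<beta>). homology_inclusion k n (sublevel s d M w \<beta>))\<rparr>"

definition slice :: "('a \<times> real, 'k, 'b) diagram \<Rightarrow> 'a \<Rightarrow> (real, 'k, 'b) diagram" where
  "slice G w = \<lparr>obj = (\<lambda>\<beta>. obj G (w, \<beta>)), arr = (\<lambda>\<beta> \<beta>'. arr G (w, \<beta>) (w, \<beta>'))\<rparr>"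

definition PHT_left :: "('k, 'r) ring_scheme \<Rightarrow> setting \<Rightarrow> nat \<Rightarrow> nat \<Rightarrow> (nat \<Rightarrow> real) set \<Rightarrow>
    (nat \<Rightarrow> real) set \<Rightarrow> (nat \<Rightarrow> real) \<Rightarrow> (real, 'k, ((nat \<Rightarrow> real) \<times> real \<Rightarrow> 'k homology_class) set) diagram" where
  "PHT_left k s d n M A =
     slice (left_kan k (A \<times> interval s) (spacetime_le s d) (spacetime_diagram k s d n M))"

definition PHT_right :: "('k, 'r) ring_scheme \<Rightarrow> setting \<Rightarrow> nat \<Rightarrow> nat \<Rightarrow> (nat \<Rightarrow> real) set \<Rightarrow>
    (nat \<Rightarrow> real) set \<Rightarrow> (nat \<Rightarrow> real) \<Rightarrow> (real, 'k, (nat \<Rightarrow> real) \<times> real \<Rightarrow> 'k homology_class) diagram" where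
  "PHT_right k s d n M A =
     slice (right_kan (A \<times> interval s) (spacetime_le s d) (spacetime_diagram k s d n M))"

definition PHT_center :: "('k, 'r) ring_scheme \<Rightarrow> setting \<Rightarrow> nat \<Rightarrow> nat \<Rightarrow> (nat \<Rightarrow> real) set \<Rightarrow>
    (nat \<Rightarrow> real) set \<Rightarrow> (nat \<Rightarrow> real) \<Rightarrow> (real, 'k, (nat \<Rightarrow> real) \<times> real \<Rightarrow> 'k homology_class) diagram" where
  "PHT_center k s d n M A =
     slice (center_kan k (A \<times> interval s) (spacetime_le s d) (spacetime_diagram k s d n M))"

end

theory Submission
  imports Defs
begin

text \<open>The three Kan extensions are compared with the transform in one direction \<open>w\<close> at a time.
  Let \<open>v \<in> A\<close> have distance \<open>\<delta>\<close> from \<open>w\<close>. In the space-time category there are morphisms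
  \<open>(w, x) \<rightarrow> (v, x + \<delta>) \<rightarrow> (w, x + 2 \<delta>)\<close>, with times truncated at the top of the interval. So the shift by
  \<open>2 \<delta>\<close> along the slice at \<open>w\<close> factors through a sampled object. This alone yields a
  \<open>2 \<delta>\<close>-interleaving: a class at \<open>(w, x)\<close> is pushed to \<open>(v, x + \<delta>)\<close> and enters the colimit at
  \<open>(w, x + 2 \<delta>)\<close> there; a family in the limit at \<open>(w, x)\<close> is evaluated at \<open>(v, x + \<delta>)\<close> and pushed to
  \<open>(w, x + 2 \<delta>)\<close>; the remaining two maps are the canonical ones. The maps for the limit also
  serve the center Kan extension, because the canonical map from colimit to limit turns the map into
  the colimit into the map into the limit. These interleavings are constructed in the locale
  \<open>sampled_slice\<close>, for an arbitrary diagram on a pre-order. Letting \<open>v\<close> range over \<open>A\<close> and \<open>w\<close> over the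
  sphere gives the bound by twice the Hausdorff distance.

  The abstract argument needs two facts about the transform. The first is that the space-time diagram
  is a functor to modules. Algebraically, homology is a subquotient of the module of all functions
  on simplices, and inclusions act on cosets by enlarging the denominator. Geometrically, a morphism
  \<open>(v, \<alpha>) \<rightarrow> (w, \<beta>)\<close> must induce an inclusion of sublevel sets (\<open>dot_le_threshold\<close>); in the
  height setting this is Cauchy-Schwarz, and in the angle setting it is \<open>dot_le_geodesic\<close>. The second fact is that the
  morphisms compose, that is, the triangle inequality on the sphere; for the geodesic distance it
  is again an instance of \<open>dot_le_geodesic\<close>, applied to an antipodal point.\<close>

section \<open>Linear maps, submodules and quotients\<close>

lemma linear_mapI:
  assumes "\<And>x. x \<in> carrier V \<Longrightarrow> f x \<in> carrier W"
    and "\<And>x y. x \<in> carrier V \<Longrightarrow> y \<in> carrier V \<Longrightarrow> f (x \<oplus>\<^bsub>V\<^esub> y) = f x \<oplus>\<^bsub>W\<^esub> f y"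
    and "\<And>a x. a \<in> carrier k \<Longrightarrow> x \<in> carrier V \<Longrightarrow> f (a \<odot>\<^bsub>V\<^esub> x) = a \<odot>\<^bsub>W\<^esub> f x"
  shows "linear_map k V W f"
  using assms by (auto simp: linear_map_def)

lemma linear_mapD:
  assumes "linear_map k V W f" "x \<in> carrier V"
  shows "f x \<in> carrier W"
    and "y \<in> carrier V \<Longrightarrow> f (x \<oplus>\<^bsub>V\<^esub> y) = f x \<oplus>\<^bsub>W\<^esub> f y"
    and "a \<in> carrier k \<Longrightarrow> f (a \<odot>\<^bsub>V\<^esub> x) = a \<odot>\<^bsub>W\<^esub> f x"
  using assms by (auto simp: linear_map_def)

lemma linear_map_comp:
  assumes "linear_map k U V f" "linear_map k V W g"
  shows "linear_map k U W (\<lambda>x. g (f x))"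
  using assms by (auto simp: linear_map_def Pi_iff)

lemma linear_map_zero:
  assumes "module k V" "module k W" "linear_map k V W f"
  shows "f \<zero>\<^bsub>V\<^esub> = \<zero>\<^bsub>W\<^esub>"
proof -
  interpret V: module k V by fact
  interpret W: module k W by fact
  have "f \<zero>\<^bsub>V\<^esub> = f (\<zero>\<^bsub>k\<^esub> \<odot>\<^bsub>V\<^esub> \<zero>\<^bsub>V\<^esub>)" by simp
  also have "\<dots> = \<zero>\<^bsub>k\<^esub> \<odot>\<^bsub>W\<^esub> f \<zero>\<^bsub>V\<^esub>" by (rule linear_mapD(3)[OF assms(3)]) auto
  also have "\<dots> = \<zero>\<^bsub>W\<^esub>" using linear_mapD(1)[OF assms(3)] by simp
  finally show ?thesis .
qed

lemma linear_map_minus: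
  assumes "module k V" "module k W" "linear_map k V W f" "x \<in> carrier V" "y \<in> carrier V"
  shows "f (x \<ominus>\<^bsub>V\<^esub> y) = f x \<ominus>\<^bsub>W\<^esub> f y"
proof -
  interpret V: module k V by fact
  interpret W: module k W by fact
  have "x \<ominus>\<^bsub>V\<^esub> y = x \<oplus>\<^bsub>V\<^esub> (\<ominus>\<^bsub>k\<^esub> \<one>\<^bsub>k\<^esub>) \<odot>\<^bsub>V\<^esub> y"
    using assms(4,5) by (simp add: a_minus_def V.smult_l_minus)
  also have "f \<dots> = f x \<oplus>\<^bsub>W\<^esub> (\<ominus>\<^bsub>k\<^esub> \<one>\<^bsub>k\<^esub>) \<odot>\<^bsub>W\<^esub> f y"
    using assms(4,5) by (simp add: linear_mapD[OF assms(3)])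
  also have "\<dots> = f x \<ominus>\<^bsub>W\<^esub> f y"
    using assms(4,5) linear_mapD(1)[OF assms(3)] by (simp add: a_minus_def W.smult_l_minus)
  finally show ?thesis .
qed

text \<open>The module axioms are equations, so they pass to any image under an operation-preserving map.
  This turns a quotient into a module without verifying the axioms on cosets.\<close>

lemma module_surj_image:
  assumes "module k V" and f: "linear_map k V W f"
    and surj: "carrier W = f ` carrier V" and zero: "f \<zero>\<^bsub>V\<^esub> = \<zero>\<^bsub>W\<^esub>"
  shows "module k W"
proof -
  interpret V: module k V by fact
  note fD [simp] = linear_mapD(2,3)[OF f, symmetric]
  note z = zero[symmetric]
  have ag: "abelian_group W"
  proof (rule abelian_groupI)
    fix x assume "x \<in> carrier W"
    then obtain u where u: "u \<in> carrier V" "x = f u" using surj by auto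
    have "f (\<ominus>\<^bsub>V\<^esub> u) \<oplus>\<^bsub>W\<^esub> x = \<zero>\<^bsub>W\<^esub>" using u by (simp add: z V.l_neg)
    then show "\<exists>y\<in>carrier W. y \<oplus>\<^bsub>W\<^esub> x = \<zero>\<^bsub>W\<^esub>" using u surj by auto
  qed (auto simp: surj z V.a_ac)
  show ?thesis
    by (rule moduleI[OF V.is_cring ag])
      (auto simp: surj V.smult_l_distr V.smult_r_distr V.smult_assoc1)
qed

lemma submoduleI_smult:
  assumes "module k V" "H \<subseteq> carrier V" "\<zero>\<^bsub>V\<^esub> \<in> H"
    and "\<And>a b. a \<in> H \<Longrightarrow> b \<in> H \<Longrightarrow> a \<oplus>\<^bsub>V\<^esub> b \<in> H"
    and sm: "\<And>a x. a \<in> carrier k \<Longrightarrow> x \<in> H \<Longrightarrow> a \<odot>\<^bsub>V\<^esub> x \<in> H"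
  shows "submodule H k V"
proof -
  interpret V: module k V by fact
  show ?thesis
  proof (rule V.submoduleI)
    fix a assume a: "a \<in> H"
    have "\<ominus>\<^bsub>V\<^esub> a = (\<ominus>\<^bsub>k\<^esub> \<one>\<^bsub>k\<^esub>) \<odot>\<^bsub>V\<^esub> a"
      using a assms(2) by (subst V.smult_l_minus) auto
    then show "\<ominus>\<^bsub>V\<^esub> a \<in> H" using sm[OF _ a] by simp
  qed (use assms in auto)
qed

lemma submoduleD:
  assumes "submodule H k V"
  shows "H \<subseteq> carrier V" "\<zero>\<^bsub>V\<^esub> \<in> H"
    and "\<And>a b. a \<in> H \<Longrightarrow> b \<in> H \<Longrightarrow> a \<oplus>\<^bsub>V\<^esub> b \<in> H"
    and "\<And>a x. a \<in> carrier k \<Longrightarrow> x \<in> H \<Longrightarrow> a \<odot>\<^bsub>V\<^esub> x \<in> H"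
    and "\<And>a. a \<in> H \<Longrightarrow> \<ominus>\<^bsub>V\<^esub> a \<in> H"
proof -
  interpret submodule H k V by fact
  show "H \<subseteq> carrier V" "\<zero>\<^bsub>V\<^esub> \<in> H"
    "\<And>a b. a \<in> H \<Longrightarrow> b \<in> H \<Longrightarrow> a \<oplus>\<^bsub>V\<^esub> b \<in> H"
    "\<And>a x. a \<in> carrier k \<Longrightarrow> x \<in> H \<Longrightarrow> a \<odot>\<^bsub>V\<^esub> x \<in> H"
    "\<And>a. a \<in> H \<Longrightarrow> \<ominus>\<^bsub>V\<^esub> a \<in> H"
    using subset one_closed m_closed m_inv_closed by (auto simp: a_inv_def)
qed

text \<open>The uniqueness statements below are obtained from equalizers: two linear maps that agree on a
  generating set agree, since the set where they agree is a submodule.\<close>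

lemma submodule_equalizer:
  assumes "module k V" "module k W" "linear_map k V W f" "linear_map k V W g"
  shows "submodule {x \<in> carrier V. f x = g x} k V"
proof -
  interpret V: module k V by fact
  show ?thesis
    using linear_map_zero[OF assms(1,2,3)] linear_map_zero[OF assms(1,2,4)]
    by (intro submoduleI_smult[OF assms(1)])
      (auto simp: linear_mapD[OF assms(3)] linear_mapD[OF assms(4)])
qed

text \<open>A hull is an intersection of submodules; the carrier bounds it, so the family that is
  intersected is not empty.\<close>

lemma submodule_hull:
  assumes "module k V" "S \<subseteq> carrier V"
  shows "submodule ((\<lambda>N. submodule N k V) hull S) k V"
proof -
  interpret V: module k V by fact
  have "(\<lambda>N. submodule N k V) hull S \<subseteq> carrier V"
    by (rule hull_minimal[where S="\<lambda>N. submodule N k V"]) (use assms V.carrier_is_submodule in auto)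
  then show ?thesis
    by (intro submoduleI_smult[OF assms(1)]) (auto simp: hull_def dest: submoduleD)
qed

text \<open>Both quotients that occur, homology and colimits, are taken of a submodule \<open>Z\<close> of a module \<open>F\<close>.
  In the homology module the submodule \<open>Z\<close> consists of the cycles. It need not contain \<open>N\<close>:
  the quotient is then \<open>(Z + N) / N\<close> inside \<open>F / N\<close>.\<close>

locale subquotient =
  fixes k :: "('k, 'r) ring_scheme" and F :: "('k, 'b) module" and Z N :: "'b set"
  assumes module_F: "module k F" and sub_Z: "submodule Z k F" and sub_N: "submodule N k F"
begin

interpretation F: module k F by (rule module_F)

lemma Z_carrier: "z \<in> Z \<Longrightarrow> z \<in> carrier F"
  using submoduleD(1)[OF sub_Z] by blast

lemma N_carrier: "z \<in> N \<Longrightarrow> z \<in> carrier F"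
  using submoduleD(1)[OF sub_N] by blast

lemma N_subgroup: "subgroup N (add_monoid F)"
  using sub_N by (rule submodule.axioms)

lemma coset_eq_iff:
  assumes "x \<in> carrier F" "y \<in> carrier F"
  shows "N +>\<^bsub>F\<^esub> x = N +>\<^bsub>F\<^esub> y \<longleftrightarrow> x \<ominus>\<^bsub>F\<^esub> y \<in> N"
proof
  assume eq: "N +>\<^bsub>F\<^esub> x = N +>\<^bsub>F\<^esub> y"
  have "\<zero>\<^bsub>F\<^esub> \<oplus>\<^bsub>F\<^esub> x \<in> N +>\<^bsub>F\<^esub> x"
    unfolding a_r_coset_def' using submoduleD(2)[OF sub_N] by blast
  then obtain h where h: "h \<in> N" "x = h \<oplus>\<^bsub>F\<^esub> y"
    using eq assms by (auto simp: a_r_coset_def')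
  then show "x \<ominus>\<^bsub>F\<^esub> y \<in> N"
    using assms N_carrier by (simp add: a_minus_def F.a_assoc F.r_neg)
next
  assume n: "x \<ominus>\<^bsub>F\<^esub> y \<in> N"
  have "x = (x \<ominus>\<^bsub>F\<^esub> y) \<oplus>\<^bsub>F\<^esub> y" using assms by (simp add: a_minus_def F.a_assoc F.l_neg)
  then have "x \<in> N +>\<^bsub>F\<^esub> y" unfolding a_r_coset_def' using n by blast
  then show "N +>\<^bsub>F\<^esub> x = N +>\<^bsub>F\<^esub> y"
    using F.a_repr_independence'[OF _ assms(2) N_subgroup] by (simp add: a_r_coset_def)
qed

lemma coset_self: "x \<in> carrier F \<Longrightarrow> x \<in> N +>\<^bsub>F\<^esub> x"
  unfolding a_r_coset_def' using submoduleD(2)[OF sub_N] by force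

lemma coset_absorb:
  assumes "h \<in> N" "x \<in> carrier F"
  shows "N +>\<^bsub>F\<^esub> (h \<oplus>\<^bsub>F\<^esub> x) = N +>\<^bsub>F\<^esub> x"
  using assms N_carrier
  by (subst coset_eq_iff) (auto simp: a_minus_def F.a_assoc F.r_neg)

lemma coset_add:
  assumes "x \<in> carrier F" "y \<in> carrier F"
  shows "(N +>\<^bsub>F\<^esub> x) <+>\<^bsub>F\<^esub> (N +>\<^bsub>F\<^esub> y) = N +>\<^bsub>F\<^esub> (x \<oplus>\<^bsub>F\<^esub> y)"
proof (rule equalityI; rule subsetI)
  fix u assume "u \<in> (N +>\<^bsub>F\<^esub> x) <+>\<^bsub>F\<^esub> (N +>\<^bsub>F\<^esub> y)"
  then obtain h g where hg: "h \<in> N" "g \<in> N" "u = (h \<oplus>\<^bsub>F\<^esub> x) \<oplus>\<^bsub>F\<^esub> (g \<oplus>\<^bsub>F\<^esub> y)"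
    by (auto simp: set_add_def' a_r_coset_def')
  then have "u = (h \<oplus>\<^bsub>F\<^esub> g) \<oplus>\<^bsub>F\<^esub> (x \<oplus>\<^bsub>F\<^esub> y)"
    using assms N_carrier by (simp add: F.a_ac)
  then show "u \<in> N +>\<^bsub>F\<^esub> (x \<oplus>\<^bsub>F\<^esub> y)"
    using submoduleD(3)[OF sub_N hg(1,2)] by (auto simp: a_r_coset_def')
next
  fix u assume "u \<in> N +>\<^bsub>F\<^esub> (x \<oplus>\<^bsub>F\<^esub> y)"
  then obtain h where h: "h \<in> N" "u = h \<oplus>\<^bsub>F\<^esub> (x \<oplus>\<^bsub>F\<^esub> y)" by (auto simp: a_r_coset_def')
  have "u = (h \<oplus>\<^bsub>F\<^esub> x) \<oplus>\<^bsub>F\<^esub> (\<zero>\<^bsub>F\<^esub> \<oplus>\<^bsub>F\<^esub> y)"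
    using h assms N_carrier by (simp add: F.a_assoc)
  then show "u \<in> (N +>\<^bsub>F\<^esub> x) <+>\<^bsub>F\<^esub> (N +>\<^bsub>F\<^esub> y)"
    unfolding set_add_def' a_r_coset_def' using h(1) submoduleD(2)[OF sub_N] by blast
qed

text \<open>The left-hand side is the scalar multiplication of a quotient module: all its members coincide,
  since a representative \<open>h + x\<close> is scaled to \<open>a h + a x\<close>, which lies in the coset of \<open>a x\<close>.\<close>

lemma coset_smult:
  assumes "a \<in> carrier k" "x \<in> carrier F"
  shows "(\<Union>y\<in>N +>\<^bsub>F\<^esub> x. N +>\<^bsub>F\<^esub> (a \<odot>\<^bsub>F\<^esub> y)) = N +>\<^bsub>F\<^esub> (a \<odot>\<^bsub>F\<^esub> x)"
proof -
  have "N +>\<^bsub>F\<^esub> (a \<odot>\<^bsub>F\<^esub> y) = N +>\<^bsub>F\<^esub> (a \<odot>\<^bsub>F\<^esub> x)" if y: "y \<in> N +>\<^bsub>F\<^esub> x" for y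
  proof -
    obtain h where h: "h \<in> N" "y = h \<oplus>\<^bsub>F\<^esub> x" using y by (auto simp: a_r_coset_def')
    then show ?thesis
      using assms N_carrier by (simp add: F.smult_r_distr coset_absorb submoduleD(4)[OF sub_N])
  qed
  then show ?thesis using coset_self[OF assms(2)] by blast
qed

abbreviation "Q \<equiv> quotient_module (F\<lparr>carrier := Z\<rparr>) N"

lemma quotient_carrier: "carrier Q = (\<lambda>z. N +>\<^bsub>F\<^esub> z) ` Z"
  by (auto simp: quotient_module_def A_RCOSETS_def' a_r_coset_def')

lemma coset_map_linear: "linear_map k (F\<lparr>carrier := Z\<rparr>) Q (\<lambda>z. N +>\<^bsub>F\<^esub> z)"
proof (rule linear_mapI)
  fix z y assume z: "z \<in> carrier (F\<lparr>carrier := Z\<rparr>)" and y: "y \<in> carrier (F\<lparr>carrier := Z\<rparr>)"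
  have "(N +>\<^bsub>F\<^esub> z) \<oplus>\<^bsub>Q\<^esub> (N +>\<^bsub>F\<^esub> y) = (N +>\<^bsub>F\<^esub> z) <+>\<^bsub>F\<^esub> (N +>\<^bsub>F\<^esub> y)"
    by (simp add: quotient_module_def set_add_def')
  then show "N +>\<^bsub>F\<^esub> (z \<oplus>\<^bsub>F\<lparr>carrier := Z\<rparr>\<^esub> y) = (N +>\<^bsub>F\<^esub> z) \<oplus>\<^bsub>Q\<^esub> (N +>\<^bsub>F\<^esub> y)"
    using z y by (simp add: coset_add Z_carrier)
next
  fix a z assume a: "a \<in> carrier k" and z: "z \<in> carrier (F\<lparr>carrier := Z\<rparr>)"
  have "a \<odot>\<^bsub>Q\<^esub> (N +>\<^bsub>F\<^esub> z) = (\<Union>y\<in>N +>\<^bsub>F\<^esub> z. N +>\<^bsub>F\<^esub> (a \<odot>\<^bsub>F\<^esub> y))"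
    by (simp add: quotient_module_def a_r_coset_def')
  then show "N +>\<^bsub>F\<^esub> (a \<odot>\<^bsub>F\<lparr>carrier := Z\<rparr>\<^esub> z) = a \<odot>\<^bsub>Q\<^esub> (N +>\<^bsub>F\<^esub> z)"
    using a z by (simp add: coset_smult Z_carrier)
qed (simp add: quotient_carrier)

lemma module_Z: "module k (F\<lparr>carrier := Z\<rparr>)"
  by (rule submodule.submodule_is_module[OF sub_Z module_F])

lemma module_quotient: "module k Q"
proof (rule module_surj_image[OF module_Z coset_map_linear])
  show "N +>\<^bsub>F\<^esub> \<zero>\<^bsub>F\<lparr>carrier := Z\<rparr>\<^esub> = \<zero>\<^bsub>Q\<^esub>"
    using N_carrier by (auto simp: a_r_coset_def' quotient_module_def intro: rev_bexI)
qed (simp add: quotient_carrier)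

lemma quotient_linearI:
  assumes "linear_map k (F\<lparr>carrier := Z\<rparr>) W (\<lambda>z. f (N +>\<^bsub>F\<^esub> z))"
  shows "linear_map k Q W f"
proof (rule linear_mapI)
  show "f x \<in> carrier W" if "x \<in> carrier Q" for x
    using that linear_mapD(1)[OF assms] by (auto simp: quotient_carrier)
  show "f (x \<oplus>\<^bsub>Q\<^esub> y) = f x \<oplus>\<^bsub>W\<^esub> f y" if xy: "x \<in> carrier Q" "y \<in> carrier Q" for x y
  proof -
    obtain u v where uv: "u \<in> Z" "v \<in> Z" "x = N +>\<^bsub>F\<^esub> u" "y = N +>\<^bsub>F\<^esub> v"
      using xy by (auto simp: quotient_carrier)
    then show ?thesis
      using linear_mapD(2)[OF assms, of u v] linear_mapD(2)[OF coset_map_linear, of u v] by simp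
  qed
  show "f (a \<odot>\<^bsub>Q\<^esub> x) = a \<odot>\<^bsub>W\<^esub> f x" if ax: "a \<in> carrier k" "x \<in> carrier Q" for a x
  proof -
    obtain u where u: "u \<in> Z" "x = N +>\<^bsub>F\<^esub> u" using ax by (auto simp: quotient_carrier)
    then show ?thesis
      using ax linear_mapD(3)[OF assms, of u a] linear_mapD(3)[OF coset_map_linear, of u a] by simp
  qed
qed

end

text \<open>Each representative \<open>c\<close> differs from \<open>z\<close> by an element of \<open>N \<subseteq> N'\<close>. This computes the map
  \<open>Z / N \<rightarrow> Z' / N'\<close>, which in homology is induced by an inclusion of spaces.\<close>

lemma coset_Union:
  assumes "subquotient k F Z N" "subquotient k F Z' N'" "N \<subseteq> N'" "z \<in> carrier F"
  shows "(\<Union>c\<in>N +>\<^bsub>F\<^esub> z. N' +>\<^bsub>F\<^esub> c) = N' +>\<^bsub>F\<^esub> z"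
proof -
  interpret A: subquotient k F Z N by fact
  interpret B: subquotient k F Z' N' by fact
  have "N' +>\<^bsub>F\<^esub> c = N' +>\<^bsub>F\<^esub> z" if c: "c \<in> N +>\<^bsub>F\<^esub> z" for c
  proof -
    obtain h where "h \<in> N" "c = h \<oplus>\<^bsub>F\<^esub> z" using c by (auto simp: a_r_coset_def')
    then show ?thesis using assms(3,4) B.coset_absorb by auto
  qed
  then show ?thesis using A.coset_self[OF assms(4)] by blast
qed

section \<open>Products and direct sums\<close>

lemma product_module_simps [simp]:
  "carrier (product_module I V) = (\<Pi>\<^sub>E j\<in>I. carrier (V j))"
  "\<zero>\<^bsub>product_module I V\<^esub> = (\<lambda>j\<in>I. \<zero>\<^bsub>V j\<^esub>)"
  "f \<oplus>\<^bsub>product_module I V\<^esub> g = (\<lambda>j\<in>I. f j \<oplus>\<^bsub>V j\<^esub> g j)"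
  "a \<odot>\<^bsub>product_module I V\<^esub> f = (\<lambda>j\<in>I. a \<odot>\<^bsub>V j\<^esub> f j)"
  by (simp_all add: product_module_def)

lemma product_module_module:
  assumes "cring k" and V: "\<And>j. j \<in> I \<Longrightarrow> module k (V j)"
  shows "module k (product_module I V)"
proof -
  note ag = module.axioms(2)[OF V]
  note am = abelian_group.axioms(1)[OF ag]
  have m: "f j \<in> carrier (V j)" if "f \<in> (\<Pi>\<^sub>E j\<in>I. carrier (V j))" "j \<in> I" for f j
    using that by (rule PiE_mem)
  have "abelian_group (product_module I V)"
  proof (rule abelian_groupI)
    fix f assume f: "f \<in> carrier (product_module I V)"
    let ?g = "\<lambda>j\<in>I. \<ominus>\<^bsub>V j\<^esub> f j"
    have "?g \<in> carrier (product_module I V)"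
      using f by (auto intro!: abelian_group.a_inv_closed[OF ag])
    moreover have "?g \<oplus>\<^bsub>product_module I V\<^esub> f = \<zero>\<^bsub>product_module I V\<^esub>"
      using f by (auto intro!: restrict_ext simp: abelian_group.l_neg[OF ag] m)
    ultimately show "\<exists>g\<in>carrier (product_module I V).
        g \<oplus>\<^bsub>product_module I V\<^esub> f = \<zero>\<^bsub>product_module I V\<^esub>" by blast
  qed (auto simp: abelian_monoid.a_closed[OF am] abelian_monoid.zero_closed[OF am]
      abelian_monoid.a_assoc[OF am] abelian_monoid.l_zero[OF am] PiE_iff extensional_def
      intro!: ext abelian_monoid.a_comm[OF am])
  then show ?thesis
    by (rule moduleI[OF assms(1)])
      (auto simp: module.smult_closed[OF V] module.smult_l_distr[OF V] module.smult_r_distr[OF V]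
        module.smult_assoc1[OF V] module.smult_one[OF V] abelian_monoid.a_closed[OF am]
        cring.cring_simprules[OF assms(1)] PiE_iff extensional_def intro!: ext)
qed

lemma direct_sum_simps [simp]:
  "carrier (direct_sum_module I V)
     = {f \<in> \<Pi>\<^sub>E j\<in>I. carrier (V j). finite {j\<in>I. f j \<noteq> \<zero>\<^bsub>V j\<^esub>}}"
  "\<zero>\<^bsub>direct_sum_module I V\<^esub> = (\<lambda>j\<in>I. \<zero>\<^bsub>V j\<^esub>)"
  "f \<oplus>\<^bsub>direct_sum_module I V\<^esub> g = (\<lambda>j\<in>I. f j \<oplus>\<^bsub>V j\<^esub> g j)"
  "a \<odot>\<^bsub>direct_sum_module I V\<^esub> f = (\<lambda>j\<in>I. a \<odot>\<^bsub>V j\<^esub> f j)"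
  by (simp_all add: direct_sum_module_def)

text \<open>The supports of a sum and of a scalar multiple stay finite, so the direct sum is a submodule
  of the product.\<close>

lemma direct_sum_module_module:
  assumes "cring k" and V: "\<And>j. j \<in> I \<Longrightarrow> module k (V j)"
  shows "module k (direct_sum_module I V)"
proof -
  note P = product_module_module[OF assms]
  interpret P: module k "product_module I V" by (rule P) 
  note ag = module.axioms(2)[OF V]
  note am = abelian_group.axioms(1)[OF ag]
  let ?D = "{f \<in> carrier (product_module I V). finite {j\<in>I. f j \<noteq> \<zero>\<^bsub>V j\<^esub>}}"
  have "submodule ?D k (product_module I V)"
  proof (rule submoduleI_smult[OF P])
    show "\<zero>\<^bsub>product_module I V\<^esub> \<in> ?D"
      using P.zero_closed by (auto intro: finite_subset[of _ "{}"])
  next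
    fix f g assume fg: "f \<in> ?D" "g \<in> ?D"
    have "{j\<in>I. (f \<oplus>\<^bsub>product_module I V\<^esub> g) j \<noteq> \<zero>\<^bsub>V j\<^esub>}
        \<subseteq> {j\<in>I. f j \<noteq> \<zero>\<^bsub>V j\<^esub>} \<union> {j\<in>I. g j \<noteq> \<zero>\<^bsub>V j\<^esub>}"
      by (auto simp: abelian_monoid.l_zero[OF am] abelian_monoid.zero_closed[OF am])
    moreover have "finite \<dots>" using fg by simp
    ultimately show "f \<oplus>\<^bsub>product_module I V\<^esub> g \<in> ?D"
      using fg P.a_closed by (auto intro: finite_subset simp del: product_module_simps)
  next
    fix a f assume af: "a \<in> carrier k" "f \<in> ?D"
    have "{j\<in>I. (a \<odot>\<^bsub>product_module I V\<^esub> f) j \<noteq> \<zero>\<^bsub>V j\<^esub>} \<subseteq> {j\<in>I. f j \<noteq> \<zero>\<^bsub>V j\<^esub>}"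
      using af by (auto simp: module.smult_r_null[OF V])
    then show "a \<odot>\<^bsub>product_module I V\<^esub> f \<in> ?D"
      using af P.smult_closed by (auto intro: finite_subset simp del: product_module_simps)
  qed auto
  then show ?thesis
    unfolding direct_sum_module_def by (rule submodule.submodule_is_module[OF _ P])
qed

section \<open>Colimits and limits over a pre-order\<close>

locale commuting_diagram =
  fixes k :: "('k, 'r) ring_scheme" and P :: "'i set" and rel :: "'i \<Rightarrow> 'i \<Rightarrow> bool"
    and G :: "('i, 'k, 'b) diagram"
  assumes cring: "cring k"
    and rel_trans: "\<And>i j l. i \<in> P \<Longrightarrow> j \<in> P \<Longrightarrow> l \<in> P \<Longrightarrow> rel i j \<Longrightarrow> rel j l \<Longrightarrow> rel i l"
    and obj_module: "\<And>i. i \<in> P \<Longrightarrow> module k (obj G i)"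
    and arr_linear: "\<And>i j. i \<in> P \<Longrightarrow> j \<in> P \<Longrightarrow> rel i j \<Longrightarrow>
      linear_map k (obj G i) (obj G j) (arr G i j)"
    and arr_comp: "\<And>i j l x. i \<in> P \<Longrightarrow> j \<in> P \<Longrightarrow> l \<in> P \<Longrightarrow> rel i j \<Longrightarrow> rel j l \<Longrightarrow>
      x \<in> carrier (obj G i) \<Longrightarrow> arr G j l (arr G i j x) = arr G i l x"
begin

lemma arr_closed:
  "i \<in> P \<Longrightarrow> j \<in> P \<Longrightarrow> rel i j \<Longrightarrow> x \<in> carrier (obj G i) \<Longrightarrow> arr G i j x \<in> carrier (obj G j)"
  using arr_linear by (rule linear_mapD)

definition cocone :: "'i set \<Rightarrow> ('k, 'c) module \<Rightarrow> ('i \<Rightarrow> 'b \<Rightarrow> 'c) \<Rightarrow> bool" where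
  "cocone I W \<phi> \<longleftrightarrow> (\<forall>j\<in>I. linear_map k (obj G j) W (\<phi> j)) \<and>
     (\<forall>i\<in>I. \<forall>j\<in>I. rel i j \<longrightarrow> (\<forall>x\<in>carrier (obj G i). \<phi> j (arr G i j x) = \<phi> i x))"

lemma arr_cocone:
  assumes "I \<subseteq> P" "p \<in> P" "\<And>i. i \<in> I \<Longrightarrow> rel i p"
  shows "cocone I (obj G p) (\<lambda>i. arr G i p)"
  unfolding cocone_def using assms by (blast intro: arr_linear arr_comp)

end

text \<open>All statements about the colimit over \<open>I\<close> are first proved on the direct sum \<open>D\<close>. The
  sum map of a cocone vanishes on the generating relations, hence on the hull \<open>N\<close> of them.\<close>

locale colimit = commuting_diagram k P rel G
  for k :: "('k, 'r) ring_scheme" and P :: "'i set" and rel and G :: "('i, 'k, 'b) diagram" +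
  fixes I :: "'i set"
  assumes I_sub: "I \<subseteq> P"
begin

abbreviation "D \<equiv> direct_sum_module I (obj G)"
abbreviation "N \<equiv> colim_relations k I rel G"
abbreviation "C \<equiv> colimit_module k I rel G"
abbreviation "inc \<equiv> colim_inj k I rel G"

lemma obj_module_I: "j \<in> I \<Longrightarrow> module k (obj G j)"
  using I_sub obj_module by blast

lemma D_module: "module k D"
  by (rule direct_sum_module_module[OF cring obj_module_I])

lemma zero_obj: "j \<in> I \<Longrightarrow> \<zero>\<^bsub>obj G j\<^esub> \<in> carrier (obj G j)"
  using module.axioms(2)[OF obj_module_I] by (blast intro: abelian_monoid.zero_closed abelian_group.axioms)

lemma add_zero_obj:
  assumes "j \<in> I" "x \<in> carrier (obj G j)"
  shows "\<zero>\<^bsub>obj G j\<^esub> \<oplus>\<^bsub>obj G j\<^esub> x = x" "x \<oplus>\<^bsub>obj G j\<^esub> \<zero>\<^bsub>obj G j\<^esub> = x"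
proof -
  interpret module k "obj G j" by (rule obj_module_I[OF assms(1)])
  show "\<zero>\<^bsub>obj G j\<^esub> \<oplus>\<^bsub>obj G j\<^esub> x = x" "x \<oplus>\<^bsub>obj G j\<^esub> \<zero>\<^bsub>obj G j\<^esub> = x"
    using assms(2) by simp_all
qed

lemma summand_inj_linear: "j \<in> I \<Longrightarrow> linear_map k (obj G j) D (summand_inj I G j)"
proof (rule linear_mapI)
  fix x assume "j \<in> I" "x \<in> carrier (obj G j)"
  moreover have "finite {i \<in> I. summand_inj I G j x i \<noteq> \<zero>\<^bsub>obj G i\<^esub>}"
    by (rule finite_subset[of _ "{j}"]) (auto simp: summand_inj_def)
  ultimately show "summand_inj I G j x \<in> carrier D"
    by (auto simp: summand_inj_def zero_obj)
qed (auto simp: summand_inj_def add_zero_obj zero_obj module.smult_r_null[OF obj_module_I]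
    intro!: restrict_ext)

text \<open>Induction on a finite set that contains the support: \<open>f\<close> is its component at \<open>b\<close> plus the
  family obtained by clearing that component.\<close>

lemma D_induct:
  assumes E: "submodule E k D"
    and inc: "\<And>j x. j \<in> I \<Longrightarrow> x \<in> carrier (obj G j) \<Longrightarrow> summand_inj I G j x \<in> E"
  shows "carrier D \<subseteq> E"
proof -
  have "f \<in> E" if "finite B" "B \<subseteq> I" "f \<in> carrier D" "{j\<in>I. f j \<noteq> \<zero>\<^bsub>obj G j\<^esub>} \<subseteq> B" for B f
    using that
  proof (induction B arbitrary: f)
    case empty
    then have "f = \<zero>\<^bsub>D\<^esub>" by (auto simp: fun_eq_iff PiE_iff extensional_def)
    then show ?case using submoduleD(2)[OF E] by (simp del: direct_sum_simps)
  next
    case (insert b B)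
    let ?g = "f(b := \<zero>\<^bsub>obj G b\<^esub>)"
    have f: "f \<in> (\<Pi>\<^sub>E j\<in>I. carrier (obj G j))" using insert.prems by simp
    have b: "b \<in> I" using insert.prems by simp
    then have fb: "f b \<in> carrier (obj G b)" using f by (rule PiE_mem[rotated])
    have supp: "{j\<in>I. ?g j \<noteq> \<zero>\<^bsub>obj G j\<^esub>} \<subseteq> B" using insert.prems by auto
    have "?g \<in> carrier D"
      using f b finite_subset[OF supp insert.hyps(1)] by (auto simp: PiE_iff extensional_def zero_obj)
    then have "?g \<in> E" using insert.IH[OF _ _ supp] insert.prems(1) by blast
    moreover have "f = ?g \<oplus>\<^bsub>D\<^esub> summand_inj I G b (f b)"
      using f b by (auto simp: fun_eq_iff PiE_iff extensional_def summand_inj_def add_zero_obj)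
    ultimately show ?case
      using submoduleD(3)[OF E] inc[OF b fb] by metis
  qed
  then show ?thesis by (auto simp del: direct_sum_simps(2-)) 
qed

lemma gen_carrier:
  "{summand_inj I G i x \<ominus>\<^bsub>D\<^esub> summand_inj I G j (arr G i j x) | i j x.
     i \<in> I \<and> j \<in> I \<and> rel i j \<and> x \<in> carrier (obj G i)} \<subseteq> carrier D"
proof -
  interpret D: module k D by (rule D_module)
  have "arr G i j x \<in> carrier (obj G j)"
    if "i \<in> I" "j \<in> I" "rel i j" "x \<in> carrier (obj G i)" for i j x
    using that I_sub arr_closed by blast
  then show ?thesis
    using linear_mapD(1)[OF summand_inj_linear]
    by (auto simp del: direct_sum_simps intro!: D.minus_closed)
qed

lemma subquotient: "subquotient k D (carrier D) N"
  unfolding colim_relations_def Let_def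
  by (intro subquotient.intro D_module submodule_hull gen_carrier
      module.carrier_is_submodule[OF D_module])

sublocale C: subquotient k D "carrier D" N
  rewrites "D\<lparr>carrier := carrier D\<rparr> = D" and "quotient_module D N = C"
  by (rule subquotient) (simp_all add: colimit_module_def)

lemma C_module: "module k C"
  by (rule C.module_quotient)

lemma inc_eq: "inc j x = N +>\<^bsub>D\<^esub> summand_inj I G j x"
  by (simp add: colim_inj_def)

lemma inc_linear: "j \<in> I \<Longrightarrow> linear_map k (obj G j) C (inc j)"
  using linear_map_comp[OF summand_inj_linear C.coset_map_linear] by (simp add: colim_inj_def[abs_def])

lemma inc_arr:
  assumes "i \<in> I" "j \<in> I" "rel i j" "x \<in> carrier (obj G i)"
  shows "inc j (arr G i j x) = inc i x"
proof -
  have "arr G i j x \<in> carrier (obj G j)" using assms I_sub arr_closed by blast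
  moreover have "summand_inj I G i x \<ominus>\<^bsub>D\<^esub> summand_inj I G j (arr G i j x) \<in> N"
    unfolding colim_relations_def Let_def by (rule hull_inc) (use assms in blast)
  ultimately show ?thesis
    using assms linear_mapD(1)[OF summand_inj_linear]
    by (subst eq_commute) (simp add: inc_eq C.coset_eq_iff del: direct_sum_simps)
qed

lemma inc_cocone: "cocone I C inc"
  unfolding cocone_def using inc_linear inc_arr by blast

text \<open>The uniqueness half of the universal property of the colimit.\<close>

lemma colimit_eqI:
  assumes "module k W" "linear_map k C W f" "linear_map k C W g"
    and "\<And>j x. j \<in> I \<Longrightarrow> x \<in> carrier (obj G j) \<Longrightarrow> f (inc j x) = g (inc j x)"
    and "c \<in> carrier C"
  shows "f c = g c"
proof -
  have "carrier D \<subseteq> {z \<in> carrier D. f (N +>\<^bsub>D\<^esub> z) = g (N +>\<^bsub>D\<^esub> z)}"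
    by (rule D_induct, rule submodule_equalizer[OF D_module assms(1)])
      (use assms(2-4) linear_map_comp[OF C.coset_map_linear] linear_mapD(1)[OF summand_inj_linear]
        in \<open>auto simp: inc_eq simp del: direct_sum_simps\<close>)
  then show ?thesis using assms(5) by (auto simp: C.quotient_carrier simp del: direct_sum_simps)
qed

definition sum_map :: "('k, 'c) module \<Rightarrow> ('i \<Rightarrow> 'b \<Rightarrow> 'c) \<Rightarrow> ('i \<Rightarrow> 'b) \<Rightarrow> 'c" where
  "sum_map W \<phi> f = (\<Oplus>\<^bsub>W\<^esub>j\<in>{j\<in>I. f j \<noteq> \<zero>\<^bsub>obj G j\<^esub>}. \<phi> j (f j))"

context
  fixes W :: "('k, 'c) module" and \<phi> :: "'i \<Rightarrow> 'b \<Rightarrow> 'c"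
  assumes W: "module k W" and \<phi>: "cocone I W \<phi>"
begin

interpretation W: module k W by (rule W)

lemma \<phi>_linear: "j \<in> I \<Longrightarrow> linear_map k (obj G j) W (\<phi> j)"
  using \<phi> by (simp add: cocone_def)

text \<open>The components outside the support contribute \<open>\<phi> j 0 = 0\<close>. So sums of two families can be
  compared over one common index set, although their supports differ.\<close>

lemma sum_map_superset:
  assumes "f \<in> (\<Pi>\<^sub>E j\<in>I. carrier (obj G j))" "finite B" "B \<subseteq> I"
    and "{j\<in>I. f j \<noteq> \<zero>\<^bsub>obj G j\<^esub>} \<subseteq> B"
  shows "sum_map W \<phi> f = (\<Oplus>\<^bsub>W\<^esub>j\<in>B. \<phi> j (f j))"
  unfolding sum_map_def
proof (rule W.add.finprod_mono_neutral_cong_left)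
  show "\<phi> i (f i) = \<zero>\<^bsub>W\<^esub>" if "i \<in> B - {j\<in>I. f j \<noteq> \<zero>\<^bsub>obj G j\<^esub>}" for i
    using that assms linear_map_zero[OF obj_module_I W \<phi>_linear] by auto
  show "(\<lambda>j. \<phi> j (f j)) \<in> B \<rightarrow> carrier W"
    using assms linear_mapD(1)[OF \<phi>_linear] by (auto simp: PiE_iff subset_iff)
qed (use assms in auto)

lemma sum_map_linear: "linear_map k D W (sum_map W \<phi>)"
proof (rule linear_mapI)
  note c = linear_mapD(1)[OF \<phi>_linear]
  note sup = sum_map_superset
  fix f assume f: "f \<in> carrier D"
  let ?A = "{j\<in>I. f j \<noteq> \<zero>\<^bsub>obj G j\<^esub>}"
  have f': "f j \<in> carrier (obj G j)" if "j \<in> I" for j using f that by auto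
  then have A: "(\<lambda>j. \<phi> j (f j)) \<in> ?A \<rightarrow> carrier W" using c by auto
  then show "sum_map W \<phi> f \<in> carrier W" unfolding sum_map_def by (rule W.finsum_closed)
  show "sum_map W \<phi> (f \<oplus>\<^bsub>D\<^esub> g) = sum_map W \<phi> f \<oplus>\<^bsub>W\<^esub> sum_map W \<phi> g" if g: "g \<in> carrier D" for g
  proof -
    let ?B = "?A \<union> {j\<in>I. g j \<noteq> \<zero>\<^bsub>obj G j\<^esub>}"
    have g': "g j \<in> carrier (obj G j)" if "j \<in> I" for j using g that by auto
    have B: "finite ?B" "?B \<subseteq> I" using f g by auto
    have "sum_map W \<phi> (f \<oplus>\<^bsub>D\<^esub> g) = (\<Oplus>\<^bsub>W\<^esub>j\<in>?B. \<phi> j ((f \<oplus>\<^bsub>D\<^esub> g) j))"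
      by (rule sup[OF _ B])
        (use module.axioms(2)[OF D_module, THEN abelian_group.axioms(1),
            THEN abelian_monoid.a_closed, OF f g] in \<open>auto simp: add_zero_obj zero_obj\<close>)
    also have "\<dots> = (\<Oplus>\<^bsub>W\<^esub>j\<in>?B. \<phi> j (f j) \<oplus>\<^bsub>W\<^esub> \<phi> j (g j))"
      by (rule W.finsum_cong') (use f' g' c linear_mapD(2)[OF \<phi>_linear] in auto)
    also have "\<dots> = (\<Oplus>\<^bsub>W\<^esub>j\<in>?B. \<phi> j (f j)) \<oplus>\<^bsub>W\<^esub> (\<Oplus>\<^bsub>W\<^esub>j\<in>?B. \<phi> j (g j))"
      by (rule W.finsum_addf) (use f' g' c in auto)
    also have "(\<Oplus>\<^bsub>W\<^esub>j\<in>?B. \<phi> j (f j)) = sum_map W \<phi> f"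
      by (rule sup[OF _ B, symmetric]) (use f in auto)
    also have "(\<Oplus>\<^bsub>W\<^esub>j\<in>?B. \<phi> j (g j)) = sum_map W \<phi> g"
      by (rule sup[OF _ B, symmetric]) (use g in auto)
    finally show ?thesis .
  qed
  show "sum_map W \<phi> (a \<odot>\<^bsub>D\<^esub> f) = a \<odot>\<^bsub>W\<^esub> sum_map W \<phi> f" if a: "a \<in> carrier k" for a
  proof -
    have B: "finite ?A" "?A \<subseteq> I" using f by auto
    have "sum_map W \<phi> (a \<odot>\<^bsub>D\<^esub> f) = (\<Oplus>\<^bsub>W\<^esub>j\<in>?A. \<phi> j ((a \<odot>\<^bsub>D\<^esub> f) j))"
      by (rule sup[OF _ B])
        (use module.smult_closed[OF D_module a f] a in
          \<open>auto simp: module.smult_r_null[OF obj_module_I]\<close>)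
    also have "\<dots> = (\<Oplus>\<^bsub>W\<^esub>j\<in>?A. a \<odot>\<^bsub>W\<^esub> \<phi> j (f j))"
      by (rule W.finsum_cong') (use f' c a linear_mapD(3)[OF \<phi>_linear] in auto)
    also have "\<dots> = a \<odot>\<^bsub>W\<^esub> sum_map W \<phi> f"
      unfolding sum_map_def by (rule W.finsum_smult_ldistr[OF B(1) a A, symmetric])
    finally show ?thesis .
  qed
qed

lemma sum_map_summand_inj:
  assumes "j \<in> I" "x \<in> carrier (obj G j)"
  shows "sum_map W \<phi> (summand_inj I G j x) = \<phi> j x"
proof -
  have "sum_map W \<phi> (summand_inj I G j x) = (\<Oplus>\<^bsub>W\<^esub>i\<in>{j}. \<phi> i (summand_inj I G j x i))"
    by (rule sum_map_superset)
      (use assms linear_mapD(1)[OF summand_inj_linear] in \<open>auto simp: summand_inj_def zero_obj\<close>)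
  also have "\<dots> = \<phi> j x"
    using assms linear_mapD(1)[OF \<phi>_linear] by (simp add: summand_inj_def)
  finally show ?thesis .
qed

lemma sum_map_relations:
  assumes "h \<in> N"
  shows "sum_map W \<phi> h = \<zero>\<^bsub>W\<^esub>"
proof -
  let ?K = "{z \<in> carrier D. sum_map W \<phi> z = \<zero>\<^bsub>W\<^esub>}"
  have "submodule ?K k D"
    by (rule submodule_equalizer[OF D_module W sum_map_linear])
      (auto simp: linear_map_def)
  moreover have "sum_map W \<phi> (summand_inj I G i x \<ominus>\<^bsub>D\<^esub> summand_inj I G j (arr G i j x)) = \<zero>\<^bsub>W\<^esub>"
    if ij: "i \<in> I" "j \<in> I" "rel i j" "x \<in> carrier (obj G i)" for i j x
  proof -
    have y: "arr G i j x \<in> carrier (obj G j)" using ij I_sub arr_closed by blast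
    have "sum_map W \<phi> (summand_inj I G i x \<ominus>\<^bsub>D\<^esub> summand_inj I G j (arr G i j x))
        = \<phi> i x \<ominus>\<^bsub>W\<^esub> \<phi> j (arr G i j x)"
      using ij y linear_mapD(1)[OF summand_inj_linear]
      by (subst linear_map_minus[OF D_module W sum_map_linear])
        (auto simp: sum_map_summand_inj simp del: direct_sum_simps)
    then show ?thesis
      using ij \<phi> linear_mapD(1)[OF \<phi>_linear] by (simp add: cocone_def a_minus_def W.r_neg)
  qed
  ultimately have "N \<subseteq> ?K"
    unfolding colim_relations_def Let_def
    using gen_carrier by (intro hull_minimal) blast+
  then show ?thesis using assms by blast
qed

text \<open>The sum map is constant on each coset, hence the unique-element description of the descended map
  really returns its value.\<close>

lemma colim_desc_coset:
  assumes "z \<in> carrier D"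
  shows "colim_desc I G W \<phi> (N +>\<^bsub>D\<^esub> z) = sum_map W \<phi> z"
proof -
  have "sum_map W \<phi> y = sum_map W \<phi> z" if y: "y \<in> N +>\<^bsub>D\<^esub> z" for y
  proof -
    obtain h where h: "h \<in> N" "y = h \<oplus>\<^bsub>D\<^esub> z" using y by (auto simp: a_r_coset_def' simp del: direct_sum_simps)
    then show ?thesis
      using assms linear_mapD(2)[OF sum_map_linear C.N_carrier[OF h(1)] assms]
        linear_mapD(1)[OF sum_map_linear assms]
      by (simp add: sum_map_relations del: direct_sum_simps)
  qed
  then have "sum_map W \<phi> ` (N +>\<^bsub>D\<^esub> z) = {sum_map W \<phi> z}"
    using C.coset_self[OF assms] by blast
  then show ?thesis by (simp add: colim_desc_def sum_map_def)
qed

text \<open>Together with the next lemma, this is the existence half of the universal property.\<close>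

lemma colim_desc_linear: "linear_map k C W (colim_desc I G W \<phi>)"
proof (rule C.quotient_linearI)
  have "linear_map k D W (\<lambda>z. colim_desc I G W \<phi> (N +>\<^bsub>D\<^esub> z)) \<longleftrightarrow> linear_map k D W (sum_map W \<phi>)"
    using module.axioms(2)[OF D_module, THEN abelian_group.axioms(1),
            THEN abelian_monoid.a_closed] module.smult_closed[OF D_module]
    by (simp add: linear_map_def colim_desc_coset Pi_iff del: direct_sum_simps)
  then show "linear_map k D W (\<lambda>z. colim_desc I G W \<phi> (N +>\<^bsub>D\<^esub> z))"
    using sum_map_linear by blast
qed

lemma colim_desc_inc:
  assumes "j \<in> I" "x \<in> carrier (obj G j)"
  shows "colim_desc I G W \<phi> (inc j x) = \<phi> j x"
  using assms linear_mapD(1)[OF summand_inj_linear]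
  by (simp add: inc_eq colim_desc_coset sum_map_summand_inj del: direct_sum_simps)

end
end

context commuting_diagram
begin

lemma limit_module:
  assumes "I \<subseteq> P"
  shows "module k (limit_module I rel G)"
proof -
  have V: "module k (obj G j)" if "j \<in> I" for j using assms that obj_module by blast
  note Pm = product_module_module[OF cring V]
  interpret Pr: module k "product_module I (obj G)" by (rule Pm)
  have mem: "f j \<in> carrier (obj G j)" if "f \<in> (\<Pi>\<^sub>E j\<in>I. carrier (obj G j))" "j \<in> I" for f j
    using that by (rule PiE_mem)
  have lin: "linear_map k (obj G i) (obj G j) (arr G i j)" if "i \<in> I" "j \<in> I" "rel i j" for i j
    using assms that arr_linear by blast
  show ?thesis
    unfolding limit_module_def
  proof (rule submodule.submodule_is_module[OF submoduleI_smult[OF Pm] Pm])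
    show "\<zero>\<^bsub>product_module I (obj G)\<^esub> \<in> {f \<in> carrier (product_module I (obj G)).
        \<forall>i\<in>I. \<forall>j\<in>I. rel i j \<longrightarrow> arr G i j (f i) = f j}"
      using Pr.zero_closed linear_map_zero[OF V V lin] by auto
  qed (use Pr.a_closed Pr.smult_closed in
      \<open>auto simp: linear_mapD(2)[OF lin] linear_mapD(3)[OF lin] mem\<close>)
qed

lemma limit_simps [simp]:
  "carrier (limit_module I rel G) = {f \<in> \<Pi>\<^sub>E j\<in>I. carrier (obj G j).
     \<forall>i\<in>I. \<forall>j\<in>I. rel i j \<longrightarrow> arr G i j (f i) = f j}"
  "f \<oplus>\<^bsub>limit_module I rel G\<^esub> g = (\<lambda>j\<in>I. f j \<oplus>\<^bsub>obj G j\<^esub> g j)"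
  "a \<odot>\<^bsub>limit_module I rel G\<^esub> f = (\<lambda>j\<in>I. a \<odot>\<^bsub>obj G j\<^esub> f j)"
  by (simp_all add: limit_module_def)

lemma limit_proj_linear:
  "i \<in> I \<Longrightarrow> linear_map k (limit_module I rel G) (obj G i) (\<lambda>f. f i)"
  by (rule linear_mapI) auto

lemma lim_lift_linear:
  assumes "\<And>j. j \<in> I \<Longrightarrow> linear_map k W (obj G j) (\<phi> j)"
    and "\<And>i j x. i \<in> I \<Longrightarrow> j \<in> I \<Longrightarrow> rel i j \<Longrightarrow> x \<in> carrier W \<Longrightarrow> arr G i j (\<phi> i x) = \<phi> j x"
  shows "linear_map k W (limit_module I rel G) (lim_lift I \<phi>)"
  by (rule linear_mapI)
    (auto simp: lim_lift_def assms(2) linear_mapD[OF assms(1)] intro!: restrict_ext)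

lemma arr_lim_lift_linear:
  assumes "I \<subseteq> P" "p \<in> P" "\<And>i. i \<in> I \<Longrightarrow> rel p i"
  shows "linear_map k (obj G p) (limit_module I rel G) (lim_lift I (arr G p))"
  by (rule lim_lift_linear) (use assms in \<open>auto intro: arr_linear arr_comp simp: subset_iff\<close>)

end

section \<open>Kan extensions of a diagram that factors through small shifts\<close>

lemma natural_transI:
  assumes "\<And>x. x \<in> X \<Longrightarrow> linear_map k (obj U x) (obj V x) (\<Phi> x)"
    and "\<And>x y u. x \<in> X \<Longrightarrow> y \<in> X \<Longrightarrow> x \<le> y \<Longrightarrow> u \<in> carrier (obj U x) \<Longrightarrow>
      \<Phi> y (arr U x y u) = arr V x y (\<Phi> x u)"
  shows "natural_trans k X U V \<Phi>"
  using assms by (simp add: natural_trans_def)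

lemma shifted_simps [simp]:
  "obj (shifted X \<epsilon> U) x = obj U (time_shift X \<epsilon> x)"
  "arr (shifted X \<epsilon> U) x y = arr U (time_shift X \<epsilon> x) (time_shift X \<epsilon> y)"
  by (simp_all add: shifted_def)

lemma time_shift_twice: "0 \<le> \<epsilon> \<Longrightarrow> time_shift X (2 * \<epsilon>) x = time_shift X \<epsilon> (time_shift X \<epsilon> x)"
  by (auto simp: time_shift_def min_def)

lemma time_shift_mono: "x \<le> y \<Longrightarrow> time_shift X \<epsilon> x \<le> time_shift X \<epsilon> y"
  by (auto simp: time_shift_def)

text \<open>The pattern behind all three interleavings. The slice at \<open>w\<close> need not meet the sampled
  objects \<open>J\<close>, but a shift by \<open>\<epsilon>\<close> along the slice factors through an object \<open>q x\<close> of \<open>J\<close>: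
  \<open>(w, x) \<rightarrow> q x \<rightarrow> (w, T x)\<close>, naturally in \<open>x\<close>. So \<open>q x\<close> lies below \<open>(w, T x)\<close>, hence in the index set
  of the colimit at \<open>(w, T x)\<close>, and above \<open>(w, x)\<close>, hence in the index set of the limit at \<open>(w, x)\<close>.\<close>

locale sampled_slice = commuting_diagram k P rel G
  for k :: "('k, 'r) ring_scheme" and P :: "('a \<times> real) set" and rel
    and G :: "('a \<times> real, 'k, 'b) diagram" +
  fixes J :: "('a \<times> real) set" and X :: "real set" and \<epsilon> :: real and w :: 'a
    and q :: "real \<Rightarrow> 'a \<times> real"
  assumes J_sub: "J \<subseteq> P" and eps: "0 \<le> \<epsilon>"
    and shift_closed: "\<And>x. x \<in> X \<Longrightarrow> time_shift X \<epsilon> x \<in> X"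
    and slice_P: "\<And>x. x \<in> X \<Longrightarrow> (w, x) \<in> P"
    and slice_mono: "\<And>x y. x \<in> X \<Longrightarrow> y \<in> X \<Longrightarrow> x \<le> y \<Longrightarrow> rel (w, x) (w, y)"
    and q_J: "\<And>x. x \<in> X \<Longrightarrow> q x \<in> J"
    and q_mono: "\<And>x y. x \<in> X \<Longrightarrow> y \<in> X \<Longrightarrow> x \<le> y \<Longrightarrow> rel (q x) (q y)"
    and to_q: "\<And>x. x \<in> X \<Longrightarrow> rel (w, x) (q x)"
    and from_q: "\<And>x. x \<in> X \<Longrightarrow> rel (q x) (w, time_shift X \<epsilon> x)"
begin

abbreviation T where "T \<equiv> time_shift X \<epsilon>"
abbreviation below where "below x \<equiv> {j \<in> J. rel j (w, x)}"
abbreviation above where "above x \<equiv> {j \<in> J. rel (w, x) j}"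

lemma q_P: "x \<in> X \<Longrightarrow> q x \<in> P"
  using q_J J_sub by blast

lemma shift_rel: "x \<in> X \<Longrightarrow> rel (w, x) (w, T x)"
  using to_q from_q rel_trans slice_P q_P shift_closed by blast

lemma colimit_below: "colimit k P rel G (below x)"
  using J_sub by unfold_locales auto

lemma q_below: "x \<in> X \<Longrightarrow> q x \<in> below (T x)"
  using q_J from_q by blast

lemma q_above: "x \<in> X \<Longrightarrow> q x \<in> above x"
  using q_J to_q by blast

lemma below_mono: "x \<in> X \<Longrightarrow> y \<in> X \<Longrightarrow> x \<le> y \<Longrightarrow> below x \<subseteq> below y"
  using rel_trans J_sub slice_P slice_mono by blast

lemma above_mono: "x \<in> X \<Longrightarrow> y \<in> X \<Longrightarrow> x \<le> y \<Longrightarrow> above y \<subseteq> above x"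
  using rel_trans J_sub slice_P slice_mono by blast

lemma below_shift: "x \<in> X \<Longrightarrow> below x \<subseteq> below (T x)"
  using rel_trans J_sub slice_P shift_rel shift_closed by blast

lemma above_shift: "x \<in> X \<Longrightarrow> above (T x) \<subseteq> above x"
  using rel_trans J_sub slice_P shift_rel shift_closed by blast

abbreviation "L \<equiv> slice (left_kan k J rel G) w"
abbreviation "R \<equiv> slice (right_kan J rel G) w"
abbreviation "U \<equiv> slice G w"

abbreviation inc where "inc x \<equiv> colim_inj k (below x) rel G"

lemma U_simps [simp]: "obj U x = obj G (w, x)" "arr U x y = arr G (w, x) (w, y)"
  by (simp_all add: slice_def)

lemma L_obj: "obj L x = colimit_module k (below x) rel G"
  by (simp add: left_kan_def slice_def)

lemma R_obj: "obj R x = limit_module (above x) rel G"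
  by (simp add: right_kan_def slice_def)

lemma R_arr: "arr R x y = lim_lift (above y) (\<lambda>j f. f j)"
  by (simp add: right_kan_def slice_def)

lemmas inc_linear = colimit.inc_linear[OF colimit_below]
lemmas inc_arr = colimit.inc_arr[OF colimit_below]
lemmas left_eqI = colimit.colimit_eqI[OF colimit_below, folded L_obj]

lemma L_module: "module k (obj L x)"
  unfolding L_obj by (rule colimit.C_module[OF colimit_below])

lemma inc_cocone:
  assumes "below x \<subseteq> below y"
  shows "cocone (below x) (obj L y) (inc y)"
  using colimit.inc_cocone[OF colimit_below, of y] assms unfolding L_obj cocone_def by blast

lemma L_arr_linear:
  "below x \<subseteq> below y \<Longrightarrow> linear_map k (obj L x) (obj L y) (arr L x y)"
  using colimit.colim_desc_linear[OF colimit_below L_module inc_cocone]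
  by (simp add: left_kan_def slice_def)

lemma L_arr_inc:
  "below x \<subseteq> below y \<Longrightarrow> j \<in> below x \<Longrightarrow> u \<in> carrier (obj G j) \<Longrightarrow>
    arr L x y (inc x j u) = inc y j u"
  using colimit.colim_desc_inc[OF colimit_below L_module inc_cocone]
  by (simp add: left_kan_def slice_def)

text \<open>The map into the left Kan extension pauses at the sample \<open>q x\<close>; the map back is the canonical
  map out of the colimit, followed by a shift.\<close>

definition left_\<Phi> :: "real \<Rightarrow> 'b \<Rightarrow> (('a \<times> real) \<Rightarrow> 'b) set" where
  "left_\<Phi> x u = inc (T x) (q x) (arr G (w, x) (q x) u)"

definition left_\<Psi> :: "real \<Rightarrow> (('a \<times> real) \<Rightarrow> 'b) set \<Rightarrow> 'b" where
  "left_\<Psi> x = colim_desc (below x) G (obj G (w, T x)) (\<lambda>j. arr G j (w, T x))"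

lemma \<Psi>_cocone: "x \<in> X \<Longrightarrow> cocone (below x) (obj G (w, T x)) (\<lambda>j. arr G j (w, T x))"
  using J_sub below_shift slice_P shift_closed by (intro arr_cocone) blast+

lemma left_\<Psi>_linear: "x \<in> X \<Longrightarrow> linear_map k (obj L x) (obj U (T x)) (left_\<Psi> x)"
  unfolding left_\<Psi>_def L_obj U_simps
  by (rule colimit.colim_desc_linear[OF colimit_below obj_module \<Psi>_cocone])
    (auto intro: slice_P shift_closed)

lemma left_\<Psi>_inc:
  "x \<in> X \<Longrightarrow> j \<in> below x \<Longrightarrow> u \<in> carrier (obj G j) \<Longrightarrow>
    left_\<Psi> x (inc x j u) = arr G j (w, T x) u"
  unfolding left_\<Psi>_def
  by (rule colimit.colim_desc_inc[OF colimit_below obj_module \<Psi>_cocone])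
    (auto intro: slice_P shift_closed)

lemma left_\<Phi>_linear: "x \<in> X \<Longrightarrow> linear_map k (obj U x) (obj L (T x)) (left_\<Phi> x)"
  unfolding left_\<Phi>_def[abs_def] L_obj U_simps
  by (rule linear_map_comp[OF arr_linear inc_linear[OF q_below]])
    (auto intro: slice_P q_P to_q)

text \<open>Equations between maps out of a colimit are checked on the images of the sampled objects \<open>j\<close>.
  There both sides become morphisms of the diagram, except for the choice of the sample through which
  an element enters the colimit; the relation \<open>inc j = inc (q x) \<circ> arr G j (q x)\<close> removes it.\<close>

lemma left_interleaving: "interleaving k X \<epsilon> U L left_\<Phi> left_\<Psi>"
  unfolding interleaving_def
proof (intro conjI ballI natural_transI; unfold shifted_simps time_shift_twice[OF eps])
  fix x assume x: "x \<in> X"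
  note Tx = shift_closed[OF x]
  show "linear_map k (obj U x) (obj L (T x)) (left_\<Phi> x)" by (rule left_\<Phi>_linear[OF x])
  show "linear_map k (obj L x) (obj U (T x)) (left_\<Psi> x)" by (rule left_\<Psi>_linear[OF x])
  show "left_\<Psi> (T x) (left_\<Phi> x u) = arr U x (T (T x)) u" if u: "u \<in> carrier (obj U x)" for u
  proof -
    have "left_\<Psi> (T x) (left_\<Phi> x u) = arr G (q x) (w, T (T x)) (arr G (w, x) (q x) u)"
      unfolding left_\<Phi>_def using u x
      by (intro left_\<Psi>_inc[OF Tx q_below[OF x]]) (auto intro: arr_closed slice_P q_P to_q)
    also have "\<dots> = arr G (w, x) (w, T (T x)) u"
      using u x Tx below_shift[OF Tx] q_below[OF x]
      by (intro arr_comp) (auto intro: slice_P q_P to_q shift_closed)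
    finally show ?thesis by simp
  qed
  show "left_\<Phi> (T x) (left_\<Psi> x v) = arr L x (T (T x)) v" if v: "v \<in> carrier (obj L x)" for v
  proof (rule left_eqI[OF L_module _ _ _ v])
    have sub: "below x \<subseteq> below (T (T x))" using below_shift x Tx by blast
    show "linear_map k (obj L x) (obj L (T (T x))) (\<lambda>v. left_\<Phi> (T x) (left_\<Psi> x v))"
      by (rule linear_map_comp[OF left_\<Psi>_linear[OF x] left_\<Phi>_linear[OF Tx]])
    show "linear_map k (obj L x) (obj L (T (T x))) (arr L x (T (T x)))"
      by (rule L_arr_linear[OF sub])
    fix j u assume j: "j \<in> below x" and u: "u \<in> carrier (obj G j)"
    have jT: "j \<in> below (T x)" using j below_shift[OF x] by blast
    have jq: "rel j (q (T x))"
      using jT J_sub Tx by (blast intro: rel_trans slice_P q_P to_q)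
    have "left_\<Phi> (T x) (left_\<Psi> x (inc x j u))
        = inc (T (T x)) (q (T x)) (arr G (w, T x) (q (T x)) (arr G j (w, T x) u))"
      by (simp add: left_\<Phi>_def left_\<Psi>_inc[OF x j u])
    also have "arr G (w, T x) (q (T x)) (arr G j (w, T x) u) = arr G j (q (T x)) u"
      using jT u Tx J_sub by (intro arr_comp) (auto intro: slice_P q_P to_q)
    also have "inc (T (T x)) (q (T x)) \<dots> = inc (T (T x)) j u"
      using sub j q_below[OF Tx] by (intro inc_arr jq u) auto
    also have "\<dots> = arr L x (T (T x)) (inc x j u)"
      by (rule L_arr_inc[OF sub j u, symmetric])
    finally show "left_\<Phi> (T x) (left_\<Psi> x (inc x j u)) = arr L x (T (T x)) (inc x j u)" .
  qed
next
  fix x y assume xy: "x \<in> X" "y \<in> X" "x \<le> y"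
  note Txy = shift_closed[OF xy(1)] shift_closed[OF xy(2)] time_shift_mono[OF xy(3)]
  show "left_\<Phi> y (arr U x y u) = arr L (T x) (T y) (left_\<Phi> x u)" if u: "u \<in> carrier (obj U x)" for u
  proof -
    have u': "u \<in> carrier (obj G (w, x))" using u by simp
    let ?v = "arr G (w, x) (q x) u"
    have v: "?v \<in> carrier (obj G (q x))"
      using u' xy by (intro arr_closed) (auto intro: slice_P q_P to_q)
    have sub: "below (T x) \<subseteq> below (T y)" by (rule below_mono[OF Txy])
    have "arr L (T x) (T y) (left_\<Phi> x u) = inc (T y) (q x) ?v"
      unfolding left_\<Phi>_def by (rule L_arr_inc[OF sub q_below[OF xy(1)] v])
    also have "\<dots> = inc (T y) (q y) (arr G (q x) (q y) ?v)"
      using sub q_below xy v by (intro inc_arr[symmetric] q_mono) auto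
    also have "arr G (q x) (q y) ?v = arr G (w, x) (q y) u"
      using u' xy by (intro arr_comp) (auto intro: slice_P q_P to_q q_mono)
    also have "\<dots> = arr G (w, y) (q y) (arr G (w, x) (w, y) u)"
      using u' xy by (intro arr_comp[symmetric]) (auto intro: slice_P q_P to_q slice_mono)
    finally show ?thesis by (simp add: left_\<Phi>_def)
  qed
  show "left_\<Psi> y (arr L x y v) = arr U (T x) (T y) (left_\<Psi> x v)" if v: "v \<in> carrier (obj L x)" for v
  proof (rule left_eqI[OF _ _ _ _ v])
    have sub: "below x \<subseteq> below y" by (rule below_mono[OF xy])
    show "module k (obj U (T y))" using obj_module slice_P Txy by simp
    show "linear_map k (obj L x) (obj U (T y)) (\<lambda>v. left_\<Psi> y (arr L x y v))"
      by (rule linear_map_comp[OF L_arr_linear[OF sub] left_\<Psi>_linear[OF xy(2)]])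
    have "linear_map k (obj U (T x)) (obj U (T y)) (arr U (T x) (T y))"
      using Txy by (simp add: arr_linear slice_P slice_mono)
    then show "linear_map k (obj L x) (obj U (T y)) (\<lambda>v. arr U (T x) (T y) (left_\<Psi> x v))"
      by (rule linear_map_comp[OF left_\<Psi>_linear[OF xy(1)]])
    fix j u assume j: "j \<in> below x" and u: "u \<in> carrier (obj G j)"
    have "arr U (T x) (T y) (left_\<Psi> x (inc x j u)) = arr G j (w, T y) u"
      using Txy j u J_sub below_shift[OF xy(1)]
      by (simp add: left_\<Psi>_inc[OF xy(1) j u], intro arr_comp) (auto intro: slice_P slice_mono)
    also have "\<dots> = left_\<Psi> y (arr L x y (inc x j u))"
      using left_\<Psi>_inc[OF xy(2) _ u] j sub by (subst L_arr_inc[OF sub j u]) auto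
    finally show "left_\<Psi> y (arr L x y (inc x j u)) = arr U (T x) (T y) (left_\<Psi> x (inc x j u))" ..
  qed
qed

text \<open>Dually, the map into the right Kan extension is the canonical map into the limit, and the map
  back reads off the component at the sample \<open>q x\<close>.\<close>

definition right_\<Phi> :: "real \<Rightarrow> 'b \<Rightarrow> ('a \<times> real) \<Rightarrow> 'b" where
  "right_\<Phi> x = lim_lift (above (T x)) (arr G (w, x))"

definition right_\<Psi> :: "real \<Rightarrow> (('a \<times> real) \<Rightarrow> 'b) \<Rightarrow> 'b" where
  "right_\<Psi> x f = arr G (q x) (w, T x) (f (q x))"

lemma right_\<Phi>_linear: "x \<in> X \<Longrightarrow> linear_map k (obj U x) (obj R (T x)) (right_\<Phi> x)"
  unfolding R_obj right_\<Phi>_def U_simps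
  using J_sub slice_P above_shift by (intro arr_lim_lift_linear) blast+

lemma right_\<Psi>_linear: "x \<in> X \<Longrightarrow> linear_map k (obj R x) (obj U (T x)) (right_\<Psi> x)"
  unfolding R_obj right_\<Psi>_def[abs_def] U_simps
  by (rule linear_map_comp[OF limit_proj_linear[OF q_above] arr_linear])
    (auto intro: q_P slice_P shift_closed from_q)

lemma R_memD:
  assumes "f \<in> carrier (obj R x)"
  shows "j \<in> above x \<Longrightarrow> f j \<in> carrier (obj G j)"
    and "i \<in> above x \<Longrightarrow> j \<in> above x \<Longrightarrow> rel i j \<Longrightarrow> arr G i j (f i) = f j"
proof -
  have f: "f \<in> (\<Pi>\<^sub>E j\<in>above x. carrier (obj G j)) \<and>
      (\<forall>i\<in>above x. \<forall>j\<in>above x. rel i j \<longrightarrow> arr G i j (f i) = f j)"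
    using assms unfolding R_obj limit_simps by (rule CollectD)
  show "j \<in> above x \<Longrightarrow> f j \<in> carrier (obj G j)" by (rule PiE_mem[OF conjunct1[OF f]])
  show "i \<in> above x \<Longrightarrow> j \<in> above x \<Longrightarrow> rel i j \<Longrightarrow> arr G i j (f i) = f j"
    by (rule conjunct2[OF f, THEN bspec, THEN bspec, THEN mp])
qed

text \<open>Compatibility of a family in the limit along \<open>q x \<rightarrow> j\<close> recovers each component \<open>j\<close> above
  \<open>(w, T x)\<close> from the single component at \<open>q x\<close>.\<close>

lemma right_interleaving: "interleaving k X \<epsilon> U R right_\<Phi> right_\<Psi>"
  unfolding interleaving_def
proof (intro conjI ballI natural_transI; unfold shifted_simps time_shift_twice[OF eps])
  fix x assume x: "x \<in> X"
  note Tx = shift_closed[OF x]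
  show "linear_map k (obj U x) (obj R (T x)) (right_\<Phi> x)" by (rule right_\<Phi>_linear[OF x])
  show "linear_map k (obj R x) (obj U (T x)) (right_\<Psi> x)" by (rule right_\<Psi>_linear[OF x])
  show "right_\<Psi> (T x) (right_\<Phi> x u) = arr U x (T (T x)) u" if u: "u \<in> carrier (obj U x)" for u
  proof -
    have "right_\<Psi> (T x) (right_\<Phi> x u) = arr G (q (T x)) (w, T (T x)) (arr G (w, x) (q (T x)) u)"
      using q_above[OF Tx] by (simp add: right_\<Psi>_def right_\<Phi>_def lim_lift_def)
    also have "\<dots> = arr G (w, x) (w, T (T x)) u"
      using u x Tx q_above[OF Tx] above_shift[OF x]
      by (intro arr_comp) (auto intro: slice_P q_P from_q shift_closed)
    finally show ?thesis by simp
  qed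
  show "right_\<Phi> (T x) (right_\<Psi> x f) = arr R x (T (T x)) f" if f: "f \<in> carrier (obj R x)" for f
    unfolding R_arr right_\<Phi>_def lim_lift_def
  proof (rule restrict_ext)
    fix j assume j: "j \<in> above (T (T x))"
    then have j': "j \<in> above (T x)" "j \<in> above x" using above_shift x Tx by blast+
    have jq: "rel (q x) j"
      using j'(1) x Tx J_sub by (blast intro: rel_trans slice_P q_P from_q)
    have "arr G (w, T x) j (right_\<Psi> x f) = arr G (q x) j (f (q x))"
      unfolding right_\<Psi>_def using j' x Tx J_sub R_memD(1)[OF f q_above[OF x]]
      by (intro arr_comp) (auto intro: slice_P q_P from_q)
    also have "\<dots> = f j" by (rule R_memD(2)[OF f q_above[OF x] j'(2) jq])
    finally show "arr G (w, T x) j (right_\<Psi> x f) = f j" .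
  qed
next
  fix x y assume xy: "x \<in> X" "y \<in> X" "x \<le> y"
  note Txy = shift_closed[OF xy(1)] shift_closed[OF xy(2)] time_shift_mono[OF xy(3)]
  show "right_\<Phi> y (arr U x y u) = arr R (T x) (T y) (right_\<Phi> x u)" if u: "u \<in> carrier (obj U x)" for u
    unfolding R_arr right_\<Phi>_def lim_lift_def
  proof (rule restrict_ext)
    fix j assume j: "j \<in> above (T y)"
    then have j': "j \<in> above y" "j \<in> above (T x)" using above_shift xy above_mono[OF Txy] by blast+
    have "arr G (w, y) j (arr G (w, x) (w, y) u) = arr G (w, x) j u"
      using u xy j' J_sub by (intro arr_comp) (auto intro: slice_P slice_mono)
    then show "arr G (w, y) j (arr U x y u) = (\<lambda>j\<in>above (T x). arr G (w, x) j u) j"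
      using j'(2) by simp
  qed
  show "right_\<Psi> y (arr R x y f) = arr U (T x) (T y) (right_\<Psi> x f)" if f: "f \<in> carrier (obj R x)" for f
  proof -
    note fq = R_memD(1)[OF f q_above[OF xy(1)]]
    have qy: "q y \<in> above x" using q_above xy above_mono[OF xy] by blast
    have "right_\<Psi> y (arr R x y f) = arr G (q y) (w, T y) (arr G (q x) (q y) (f (q x)))"
      using q_above[OF xy(2)] R_memD(2)[OF f q_above[OF xy(1)] qy q_mono[OF xy]]
      by (simp add: right_\<Psi>_def R_arr lim_lift_def)
    also have "\<dots> = arr G (q x) (w, T y) (f (q x))"
      using xy Txy fq by (intro arr_comp) (auto intro: slice_P q_P from_q q_mono)
    also have "\<dots> = arr G (w, T x) (w, T y) (arr G (q x) (w, T x) (f (q x)))"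
      using xy Txy fq by (intro arr_comp[symmetric]) (auto intro: slice_P q_P from_q slice_mono)
    finally show ?thesis by (simp add: right_\<Psi>_def)
  qed
qed

abbreviation "C \<equiv> slice (center_kan k J rel G) w"

lemma C_simps:
  "obj C x = (obj R x)\<lparr>carrier := kan_comparison J rel G (w, x) ` carrier (obj L x)\<rparr>"
  "arr C = arr R"
  by (simp_all add: center_kan_def slice_def)

lemma comparison_cocone:
  assumes "x \<in> X"
  shows "cocone (below x) (obj R x) (\<lambda>i. lim_lift (above x) (arr G i))"
  unfolding cocone_def R_obj
proof (intro conjI ballI impI)
  have rel: "rel i j" if "i \<in> below x" "j \<in> above x" for i j
    using that J_sub slice_P[OF assms] by (blast intro: rel_trans)
  show "linear_map k (obj G i) (limit_module (above x) rel G) (lim_lift (above x) (arr G i))"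
    if "i \<in> below x" for i
    using that rel J_sub by (intro arr_lim_lift_linear) blast+
  show "lim_lift (above x) (arr G j) (arr G i j u) = lim_lift (above x) (arr G i) u"
    if "i \<in> below x" "j \<in> below x" "rel i j" "u \<in> carrier (obj G i)" for i j u
    unfolding lim_lift_def
  proof (rule restrict_ext)
    fix l assume l: "l \<in> above x"
    have "i \<in> P" "j \<in> P" "l \<in> P" using that(1,2) l J_sub by blast+
    then show "arr G j l (arr G i j u) = arr G i l u"
      using that(3) rel[OF that(2) l] that(4) by (rule arr_comp)
  qed
qed

lemma R_module: "module k (obj R x)"
  unfolding R_obj using J_sub by (intro limit_module) auto

lemma comparison_inc:
  assumes "x \<in> X" "i \<in> below x" "u \<in> carrier (obj G i)"
  shows "kan_comparison J rel G (w, x) (inc x i u) = lim_lift (above x) (arr G i) u"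
  using colimit.colim_desc_inc[OF colimit_below R_module comparison_cocone[OF assms(1)] assms(2,3)]
  by (simp add: kan_comparison_def R_obj)

lemma comparison_linear:
  assumes "x \<in> X"
  shows "linear_map k (obj L x) (obj R x) (kan_comparison J rel G (w, x))"
  using colimit.colim_desc_linear[OF colimit_below R_module comparison_cocone[OF assms(1)]]
  by (simp add: kan_comparison_def R_obj L_obj)

text \<open>The comparison map carries the left map to the right one: both send \<open>u\<close> to the family of its
  images in the objects above \<open>(w, T x)\<close>. Hence the right map has values in the center Kan extension.\<close>

lemma right_\<Phi>_in_center:
  assumes x: "x \<in> X" and u: "u \<in> carrier (obj U x)"
  shows "right_\<Phi> x u \<in> kan_comparison J rel G (w, T x) ` carrier (obj L (T x))"
proof
  note Tx = shift_closed[OF x]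
  show "left_\<Phi> x u \<in> carrier (obj L (T x))" by (rule linear_mapD(1)[OF left_\<Phi>_linear[OF x] u])
  have "kan_comparison J rel G (w, T x) (left_\<Phi> x u)
      = lim_lift (above (T x)) (arr G (q x)) (arr G (w, x) (q x) u)"
    unfolding left_\<Phi>_def using u x
    by (intro comparison_inc[OF Tx q_below[OF x]]) (auto intro: arr_closed slice_P q_P to_q)
  also have "\<dots> = right_\<Phi> x u"
    unfolding lim_lift_def right_\<Phi>_def
  proof (rule restrict_ext)
    fix j assume j: "j \<in> above (T x)"
    then have "rel (q x) j" using x Tx J_sub by (blast intro: rel_trans slice_P q_P from_q)
    then show "arr G (q x) j (arr G (w, x) (q x) u) = arr G (w, x) j u"
      using u x j J_sub by (intro arr_comp) (auto intro: slice_P q_P to_q)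
  qed
  finally show "right_\<Phi> x u = kan_comparison J rel G (w, T x) (left_\<Phi> x u)" ..
qed

text \<open>The center Kan extension is a submodule of the right one with the same arrows, so the right
  interleaving restricts to it once its first map is known to land there.\<close>

lemma center_interleaving: "interleaving k X \<epsilon> U C right_\<Phi> right_\<Psi>"
proof -
  have sub: "carrier (obj C x) \<subseteq> carrier (obj R x)" if "x \<in> X" for x
    using linear_mapD(1)[OF comparison_linear[OF that]] by (auto simp: C_simps)
  have "linear_map k (obj U x) (obj C (T x)) (right_\<Phi> x)" if "x \<in> X" for x
    using right_\<Phi>_linear[OF that] right_\<Phi>_in_center[OF that]
    by (auto simp: linear_map_def C_simps)
  moreover have "linear_map k (obj C x) (obj U (T x)) (right_\<Psi> x)" if "x \<in> X" for x
    using right_\<Psi>_linear[OF that] sub[OF that]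
    by (auto simp: linear_map_def C_simps subset_iff Pi_iff)
  moreover have "u \<in> carrier (obj R x)" if "x \<in> X" "u \<in> carrier (obj C x)" for x u
    using that sub by blast
  ultimately show ?thesis
    using right_interleaving
    by (simp add: interleaving_def natural_trans_def C_simps(2) del: U_simps)
qed

lemma d_Int_le_eps: "interleaving k X \<epsilon> U V \<Phi> \<Psi> \<Longrightarrow> d_Int k X U V \<le> ennreal \<epsilon>"
  unfolding d_Int_def using eps by (intro Inf_lower) blast

lemmas d_Int_kan_le =
  left_interleaving[THEN d_Int_le_eps] right_interleaving[THEN d_Int_le_eps]
  center_interleaving[THEN d_Int_le_eps]

end

section \<open>Homology of subspaces as subquotients of one module\<close>

text \<open>The module of all functions into \<open>k\<close> contains the chains of every space and every degree,
  so that all homology modules are subquotients of it.\<close>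

definition function_module :: "('k, 'r) ring_scheme \<Rightarrow> ('k, 's \<Rightarrow> 'k) module" where
  "function_module k = \<lparr>carrier = {c. \<forall>\<sigma>. c \<sigma> \<in> carrier k}, mult = undefined, one = undefined,
     zero = (\<lambda>\<sigma>. \<zero>\<^bsub>k\<^esub>), add = (\<lambda>b c \<sigma>. b \<sigma> \<oplus>\<^bsub>k\<^esub> c \<sigma>), smult = (\<lambda>a c \<sigma>. a \<otimes>\<^bsub>k\<^esub> c \<sigma>)\<rparr>"

lemma function_module_simps [simp]:
  "carrier (function_module k) = {c. \<forall>\<sigma>. c \<sigma> \<in> carrier k}"
  "\<zero>\<^bsub>function_module k\<^esub> = (\<lambda>\<sigma>. \<zero>\<^bsub>k\<^esub>)"
  "b \<oplus>\<^bsub>function_module k\<^esub> c = (\<lambda>\<sigma>. b \<sigma> \<oplus>\<^bsub>k\<^esub> c \<sigma>)"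
  "a \<odot>\<^bsub>function_module k\<^esub> c = (\<lambda>\<sigma>. a \<otimes>\<^bsub>k\<^esub> c \<sigma>)"
  by (simp_all add: function_module_def)

lemma chain_module_simps [simp]:
  "\<zero>\<^bsub>chain_module k p X\<^esub> = (\<lambda>\<sigma>. \<zero>\<^bsub>k\<^esub>)"
  "b \<oplus>\<^bsub>chain_module k p X\<^esub> c = (\<lambda>\<sigma>. b \<sigma> \<oplus>\<^bsub>k\<^esub> c \<sigma>)"
  "a \<odot>\<^bsub>chain_module k p X\<^esub> c = (\<lambda>\<sigma>. a \<otimes>\<^bsub>k\<^esub> c \<sigma>)"
  by (simp_all add: chain_module_def)

lemma chain_module_restrict:
  "(chain_module k p X)\<lparr>carrier := Z\<rparr> = (function_module k)\<lparr>carrier := Z\<rparr>"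
  by (simp add: chain_module_def function_module_def)

lemma submodule_trans:
  assumes "module k F" "submodule K k F" "submodule H k (F\<lparr>carrier := K\<rparr>)"
  shows "submodule H k F"
  using submoduleD[OF assms(2)] submoduleD[OF assms(3)]
  by (intro submoduleI_smult[OF assms(1)]) auto

lemma submodule_image:
  assumes "module k V" "module k W" "linear_map k V W f"
  shows "submodule (f ` carrier V) k W"
proof -
  interpret V: module k V by fact
  show ?thesis
    using linear_map_zero[OF assms, symmetric] linear_mapD(1)[OF assms(3)]
    by (intro submoduleI_smult[OF assms(2)])
      (auto simp: linear_mapD(2,3)[OF assms(3), symmetric])
qed

context cring
begin

lemma function_module: "module R (function_module R)"
proof (rule moduleI[OF is_cring])
  show "abelian_group (function_module R :: ('a, 's \<Rightarrow> 'a) module)"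
  proof (rule abelian_groupI)
    fix c :: "'s \<Rightarrow> 'a" assume "c \<in> carrier (function_module R)"
    then show "\<exists>b\<in>carrier (function_module R). b \<oplus>\<^bsub>function_module R\<^esub> c = \<zero>\<^bsub>function_module R\<^esub>"
      by (intro bexI[of _ "\<lambda>\<sigma>. \<ominus> c \<sigma>"]) (auto simp: l_neg)
  qed (auto simp: a_assoc intro: a_comm)
qed (auto simp: l_distr r_distr m_assoc)

lemma chain_submodule: "submodule (carrier (chain_module R p X)) R (function_module R)"
proof (rule submoduleI_smult[OF function_module])
  fix b c assume bc: "b \<in> carrier (chain_module R p X)" "c \<in> carrier (chain_module R p X)"
  have sub: "{\<sigma>. b \<sigma> \<oplus> c \<sigma> \<noteq> \<zero>} \<subseteq> {\<sigma>. b \<sigma> \<noteq> \<zero>} \<union> {\<sigma>. c \<sigma> \<noteq> \<zero>}" by auto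
  with bc show "b \<oplus>\<^bsub>function_module R\<^esub> c \<in> carrier (chain_module R p X)"
    by (auto simp: chain_module_def intro: finite_subset[OF sub])
next
  fix a c assume ac: "a \<in> carrier R" "c \<in> carrier (chain_module R p X)"
  then have sub: "{\<sigma>. a \<otimes> c \<sigma> \<noteq> \<zero>} \<subseteq> {\<sigma>. c \<sigma> \<noteq> \<zero>}" by auto
  with ac show "a \<odot>\<^bsub>function_module R\<^esub> c \<in> carrier (chain_module R p X)"
    by (auto simp: chain_module_def intro: finite_subset[OF sub])
qed (auto simp: chain_module_def)

lemma chain_module_eq:
  "chain_module R p X = (function_module R)\<lparr>carrier := carrier (chain_module R p X)\<rparr>"
  by (simp add: chain_module_def function_module_def)

lemma chain_module_module: "module R (chain_module R p X)"
  by (subst chain_module_eq) (rule submodule.submodule_is_module[OF chain_submodule function_module])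

text \<open>The sum that defines the boundary runs over the support of the chain. Over a larger finite set it
  has the same value, and over a fixed set it is visibly linear in the chain.\<close>

lemma boundary_map_eq:
  assumes "finite B" "{\<sigma>. c \<sigma> \<noteq> \<zero>} \<subseteq> B" "\<And>\<sigma>. c \<sigma> \<in> carrier R"
  shows "boundary_map R p c \<tau> = (if p = 0 then \<zero> else
    (finsum R (\<lambda>(\<sigma>, i). (\<ominus> \<one>) [^] i \<otimes> c \<sigma>) {(\<sigma>, i). \<sigma> \<in> B \<and> i \<le> p \<and> singular_face p i \<sigma> = \<tau>}))"
proof -
  let ?S = "{(\<sigma>, i). \<sigma> \<in> B \<and> i \<le> p \<and> singular_face p i \<sigma> = \<tau>}"
  have "finite ?S" by (rule finite_subset[of _ "B \<times> {..p}"]) (use assms in auto)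
  then have "(finsum R (\<lambda>(\<sigma>, i). (\<ominus> \<one>) [^] i \<otimes> c \<sigma>) {(\<sigma>, i). c \<sigma> \<noteq> \<zero> \<and> i \<le> p \<and> singular_face p i \<sigma> = \<tau>})
      = (finsum R (\<lambda>(\<sigma>, i). (\<ominus> \<one>) [^] i \<otimes> c \<sigma>) ?S)"
    using assms by (intro add.finprod_mono_neutral_cong_left) auto
  then show ?thesis by (simp add: boundary_map_def)
qed

lemma boundary_map_linear:
  "linear_map R (chain_module R p X) (function_module R) (boundary_map R p)"
proof (rule linear_mapI)
  fix b assume b: "b \<in> carrier (chain_module R p X)"
  let ?B = "{\<sigma>. b \<sigma> \<noteq> \<zero>}"
  have b': "finite ?B" "\<And>\<sigma>. b \<sigma> \<in> carrier R" using b by (auto simp: chain_module_def)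
  note eqb = boundary_map_eq[OF b'(1) subset_refl b'(2)]
  show "boundary_map R p b \<in> carrier (function_module R)"
    using b' by (auto simp: eqb intro!: finsum_closed)
  show "boundary_map R p (b \<oplus>\<^bsub>chain_module R p X\<^esub> c)
      = boundary_map R p b \<oplus>\<^bsub>function_module R\<^esub> boundary_map R p c"
    if c: "c \<in> carrier (chain_module R p X)" for c
  proof
    fix \<tau>
    have c': "finite {\<sigma>. c \<sigma> \<noteq> \<zero>}" "\<And>\<sigma>. c \<sigma> \<in> carrier R"
      using c by (auto simp: chain_module_def)
    let ?C = "?B \<union> {\<sigma>. c \<sigma> \<noteq> \<zero>}"
    have C: "finite ?C" using b' c' by simp
    have sub: "{\<sigma>. b \<sigma> \<oplus> c \<sigma> \<noteq> \<zero>} \<subseteq> ?C" by auto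
    let ?S = "{(\<sigma>, i). \<sigma> \<in> ?C \<and> i \<le> p \<and> singular_face p i \<sigma> = \<tau>}"
    have "(finsum R (\<lambda>(\<sigma>, i). (\<ominus> \<one>) [^] i \<otimes> (b \<sigma> \<oplus> c \<sigma>)) ?S)
        = (\<Oplus>s\<in>?S. (case s of (\<sigma>, i) \<Rightarrow> (\<ominus> \<one>) [^] i \<otimes> b \<sigma>) \<oplus> (case s of (\<sigma>, i) \<Rightarrow> (\<ominus> \<one>) [^] i \<otimes> c \<sigma>))"
      using b' c' by (intro finsum_cong') (auto simp: r_distr)
    also have "\<dots> = (finsum R (\<lambda>(\<sigma>, i). (\<ominus> \<one>) [^] i \<otimes> b \<sigma>) ?S) \<oplus> (finsum R (\<lambda>(\<sigma>, i). (\<ominus> \<one>) [^] i \<otimes> c \<sigma>) ?S)"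
      using b' c' by (intro finsum_addf) auto
    finally show "boundary_map R p (b \<oplus>\<^bsub>chain_module R p X\<^esub> c) \<tau>
        = (boundary_map R p b \<oplus>\<^bsub>function_module R\<^esub> boundary_map R p c) \<tau>"
      using b' c' boundary_map_eq[OF C, of b p \<tau>] boundary_map_eq[OF C, of c p \<tau>]
        boundary_map_eq[OF C sub, of p \<tau>]
      by auto
  qed
  show "boundary_map R p (a \<odot>\<^bsub>chain_module R p X\<^esub> b)
      = a \<odot>\<^bsub>function_module R\<^esub> boundary_map R p b" if a: "a \<in> carrier R" for a
  proof
    fix \<tau>
    let ?S = "{(\<sigma>, i). \<sigma> \<in> ?B \<and> i \<le> p \<and> singular_face p i \<sigma> = \<tau>}"
    have S: "finite ?S" by (rule finite_subset[of _ "?B \<times> {..p}"]) (use b' in auto)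
    have sub: "{\<sigma>. a \<otimes> b \<sigma> \<noteq> \<zero>} \<subseteq> ?B" using a by auto
    have "a \<otimes> (finsum R (\<lambda>(\<sigma>, i). (\<ominus> \<one>) [^] i \<otimes> b \<sigma>) ?S)
        = (\<Oplus>s\<in>?S. a \<otimes> (case s of (\<sigma>, i) \<Rightarrow> (\<ominus> \<one>) [^] i \<otimes> b \<sigma>))"
      using b' a S by (intro finsum_rdistr) auto
    also have "\<dots> = (finsum R (\<lambda>(\<sigma>, i). (\<ominus> \<one>) [^] i \<otimes> (a \<otimes> b \<sigma>)) ?S)"
      using b' a by (intro finsum_cong') (auto simp: m_lcomm)
    finally show "boundary_map R p (a \<odot>\<^bsub>chain_module R p X\<^esub> b) \<tau>
        = (a \<odot>\<^bsub>function_module R\<^esub> boundary_map R p b) \<tau>"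
      using b' a boundary_map_eq[OF b'(1) sub, of p \<tau>] by (auto simp: eqb)
  qed
qed

lemma homology_subquotient:
  "subquotient R (function_module R) (cycles R p X) (boundaries R p X)"
proof (rule subquotient.intro)
  show "submodule (boundaries R p X) R (function_module R)"
    unfolding boundaries_def
    by (rule submodule_image[OF chain_module_module function_module boundary_map_linear])
  have "linear_map R (chain_module R p X) (function_module R) (\<lambda>c. \<zero>\<^bsub>function_module R\<^esub>)"
    by (rule linear_mapI) auto
  from submodule_equalizer[OF chain_module_module function_module boundary_map_linear this]
  have "submodule (cycles R p X) R (chain_module R p X)"
    by (simp add: cycles_def)
  then show "submodule (cycles R p X) R (function_module R)"
    by (subst (asm) chain_module_eq) (rule submodule_trans[OF function_module chain_submodule])
qed (rule function_module)

lemma homology_module_eq: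
  "homology_module R p X = quotient_module ((function_module R)\<lparr>carrier := cycles R p X\<rparr>) (boundaries R p X)"
  by (simp add: homology_module_def chain_module_restrict)

lemma homology_module_module: "module R (homology_module R p X)"
  unfolding homology_module_eq by (rule subquotient.module_quotient[OF homology_subquotient])

text \<open>What an inclusion of spaces provides is that each singular simplex of \<open>S\<close> is one of \<open>X\<close>; cycles and
  boundaries of \<open>S\<close> are then literally cycles and boundaries of \<open>X\<close>.\<close>

context
  fixes S X :: "'s topology"
  assumes simplices: "\<And>p. singular_simplex_set p S \<subseteq> singular_simplex_set p X"
begin

lemma chain_mono: "carrier (chain_module R p S) \<subseteq> carrier (chain_module R p X)"
  using simplices[of p] by (auto simp: chain_module_def)

lemma cycles_mono: "cycles R p S \<subseteq> cycles R p X"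
  using chain_mono by (auto simp: cycles_def)

lemma boundaries_mono: "boundaries R p S \<subseteq> boundaries R p X"
  using chain_mono by (auto simp: boundaries_def)

lemma homology_inclusion_coset:
  assumes "z \<in> cycles R p S"
  shows "homology_inclusion R p X (boundaries R p S +>\<^bsub>function_module R\<^esub> z)
    = boundaries R p X +>\<^bsub>function_module R\<^esub> z"
proof -
  have "z \<in> carrier (function_module R)"
    using assms subquotient.Z_carrier[OF homology_subquotient] by blast
  moreover have "boundaries R p X +>\<^bsub>chain_module R p X\<^esub> c = boundaries R p X +>\<^bsub>function_module R\<^esub> c" for c
    by (simp add: a_r_coset_def')
  ultimately show ?thesis
    using coset_Union[OF homology_subquotient homology_subquotient boundaries_mono]
    by (simp add: homology_inclusion_def)
qed

lemma homology_inclusion_linear: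
  "linear_map R (homology_module R p S) (homology_module R p X) (homology_inclusion R p X)"
  unfolding homology_module_eq
proof (rule subquotient.quotient_linearI[OF homology_subquotient])
  have "linear_map R ((function_module R)\<lparr>carrier := cycles R p S\<rparr>)
      (quotient_module ((function_module R)\<lparr>carrier := cycles R p X\<rparr>) (boundaries R p X))
      (\<lambda>z. boundaries R p X +>\<^bsub>function_module R\<^esub> z)"
    using subquotient.coset_map_linear[OF homology_subquotient, of p X] cycles_mono[of p]
    by (auto simp: linear_map_def subset_iff Pi_iff)
  then show "linear_map R ((function_module R)\<lparr>carrier := cycles R p S\<rparr>)
      (quotient_module ((function_module R)\<lparr>carrier := cycles R p X\<rparr>) (boundaries R p X))
      (\<lambda>z. homology_inclusion R p X (boundaries R p S +>\<^bsub>function_module R\<^esub> z))"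
    using submoduleD(3,4)[OF subquotient.sub_Z[OF homology_subquotient[of p S]]]
    by (simp add: linear_map_def homology_inclusion_coset Pi_iff del: function_module_simps)
qed

end

lemma homology_inclusion_comp:
  assumes "\<And>p. singular_simplex_set p S \<subseteq> singular_simplex_set p X"
    and "\<And>p. singular_simplex_set p X \<subseteq> singular_simplex_set p Y"
    and "C \<in> carrier (homology_module R p S)"
  shows "homology_inclusion R p Y (homology_inclusion R p X C) = homology_inclusion R p Y C"
proof -
  obtain z where z: "z \<in> cycles R p S" "C = boundaries R p S +>\<^bsub>function_module R\<^esub> z"
    using assms(3) unfolding homology_module_eq subquotient.quotient_carrier[OF homology_subquotient]
    by blast
  have "z \<in> cycles R p X" using z(1) cycles_mono[OF assms(1)] by blast
  moreover have "singular_simplex_set q S \<subseteq> singular_simplex_set q Y" for q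
    using assms(1)[of q] assms(2)[of q] by (rule subset_trans)
  ultimately show ?thesis
    using z assms(1,2) by (simp add: homology_inclusion_coset)
qed

end

section \<open>Sublevel sets in nearby directions\<close>

lemma dot_commute: "dot d x y = dot d y x"
  by (simp add: dot_def mult.commute)

lemma dot_diff_left: "dot d (\<lambda>i. x i - y i) z = dot d x z - dot d y z"
  by (simp add: dot_def left_diff_distrib sum_subtractf)

lemma dot_diff_right: "dot d z (\<lambda>i. x i - y i) = dot d z x - dot d z y"
  by (simp add: dot_def right_diff_distrib sum_subtractf)

lemma dot_scale_left: "dot d (\<lambda>i. c * x i) z = c * dot d x z"
  by (simp add: dot_def sum_distrib_left mult.assoc)

lemma dot_scale_right: "dot d z (\<lambda>i. c * x i) = c * dot d z x"
  by (simp add: dot_def sum_distrib_left mult.left_commute)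

lemma dot_self: "dot d x x = (L2_set x {..<d})\<^sup>2"
  by (simp add: dot_def L2_set_def sum_nonneg power2_eq_square)

lemma abs_dot_le: "\<bar>dot d x y\<bar> \<le> L2_set x {..<d} * L2_set y {..<d}"
proof -
  have "\<bar>dot d x y\<bar> \<le> (\<Sum>i<d. \<bar>x i\<bar> * \<bar>y i\<bar>)"
    unfolding dot_def by (rule order_trans[OF sum_abs]) (simp add: abs_mult)
  also have "\<dots> \<le> L2_set x {..<d} * L2_set y {..<d}" by (rule L2_set_mult_ineq)
  finally show ?thesis .
qed

lemma abs_dot_le_1:
  assumes "L2_set x {..<d} \<le> 1" "L2_set y {..<d} \<le> 1"
  shows "\<bar>dot d x y\<bar> \<le> 1"
  using abs_dot_le[of d x y] mult_mono[OF assms] by simp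

text \<open>Write \<open>x \<cdot> v = cos \<psi>\<close> and \<open>v \<cdot> w = cos \<phi>\<close>. The components of \<open>x\<close> and \<open>w\<close> orthogonal to \<open>v\<close> have length at
  most \<open>sin \<psi>\<close> and \<open>sin \<phi>\<close>, so by Cauchy-Schwarz \<open>x \<cdot> w \<le> cos \<psi> cos \<phi> + sin \<psi> sin \<phi> = cos (\<psi> - \<phi>)\<close>.
  The hypotheses give \<open>0 \<le> - \<alpha> - \<phi> \<le> \<psi> - \<phi> \<le> \<pi>\<close>, where the cosine decreases.\<close>

lemma dot_le_geodesic:
  assumes x: "L2_set x {..<d} \<le> 1" and v: "L2_set v {..<d} = 1" and w: "L2_set w {..<d} = 1"
    and \<alpha>: "-pi \<le> \<alpha>" "\<alpha> + geodesic_dist d v w \<le> 0" and le: "dot d x v \<le> cos \<alpha>"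
  shows "dot d x w \<le> cos (\<alpha> + geodesic_dist d v w)"
proof -
  define a where "a = dot d x v"
  define c where "c = dot d v w"
  define \<phi> where "\<phi> = arccos c"
  have a: "-1 \<le> a" "a \<le> 1" using abs_dot_le_1[of x d v] x v by (auto simp: a_def)
  have c: "-1 \<le> c" "c \<le> 1" using abs_dot_le_1[of v d w] v w by (auto simp: c_def)
  let ?y = "\<lambda>i. x i - a * v i" and ?u = "\<lambda>i. w i - c * v i"
  have "L2_set ?y {..<d} \<le> sqrt (1 - a\<^sup>2)"
  proof (rule real_le_rsqrt)
    have "(L2_set ?y {..<d})\<^sup>2 = (L2_set x {..<d})\<^sup>2 - a\<^sup>2"
      by (simp only: dot_self[symmetric] dot_diff_left dot_diff_right dot_scale_left dot_scale_right)
        (simp add: dot_self v dot_commute[of d v x] a_def[symmetric] power2_eq_square)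
    moreover have "(L2_set x {..<d})\<^sup>2 \<le> 1" using x by (simp add: power_le_one)
    ultimately show "(L2_set ?y {..<d})\<^sup>2 \<le> 1 - a\<^sup>2" by simp
  qed
  moreover have "L2_set ?u {..<d} \<le> sqrt (1 - c\<^sup>2)"
  proof (rule real_le_rsqrt)
    show "(L2_set ?u {..<d})\<^sup>2 \<le> 1 - c\<^sup>2"
      by (simp only: dot_self[symmetric] dot_diff_left dot_diff_right dot_scale_left dot_scale_right)
        (simp add: dot_self v w dot_commute[of d w v] c_def[symmetric] power2_eq_square)
  qed
  ultimately have "dot d ?y ?u \<le> sqrt (1 - a\<^sup>2) * sqrt (1 - c\<^sup>2)"
    using abs_dot_le[of d ?y ?u] mult_mono[of "L2_set ?y {..<d}" _ "L2_set ?u {..<d}"] a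
    by (smt (verit) L2_set_nonneg)
  moreover have "dot d ?y ?u = dot d x w - a * c"
    by (simp only: dot_diff_left dot_diff_right dot_scale_left dot_scale_right)
      (simp add: dot_self v a_def[symmetric] c_def[symmetric])
  ultimately have "dot d x w \<le> a * c + sqrt (1 - a\<^sup>2) * sqrt (1 - c\<^sup>2)" by simp
  also have "\<dots> = cos (arccos a - \<phi>)"
    using a c by (simp add: \<phi>_def cos_diff sin_arccos)
  also have "\<dots> \<le> cos (- \<alpha> - \<phi>)"
  proof (rule cos_monotone_0_pi_le)
    have g: "geodesic_dist d v w = \<phi>" by (simp add: geodesic_dist_def \<phi>_def c_def)
    then show "0 \<le> - \<alpha> - \<phi>" using \<alpha> by simp
    have \<phi>: "0 \<le> \<phi>" using c by (simp add: \<phi>_def arccos_lbound)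
    have "- \<alpha> = arccos (cos (- \<alpha>))" using \<alpha> \<phi> g by (intro arccos_cos[symmetric]) auto
    also have "\<dots> \<le> arccos a" using a le by (intro arccos_le_arccos) (auto simp: a_def)
    finally show "- \<alpha> - \<phi> \<le> arccos a - \<phi>" by simp
    show "arccos a - \<phi> \<le> pi" using arccos_ubound[of a] a \<phi> by simp
  qed
  also have "\<dots> = cos (\<alpha> + geodesic_dist d v w)"
    using cos_minus[of "\<alpha> + geodesic_dist d v w"] by (simp add: geodesic_dist_def \<phi>_def c_def)
  finally show ?thesis .
qed

text \<open>If the right-hand side is at most \<open>\<pi>\<close>, this is the previous lemma for the point \<open>- w\<close>, the
  directions \<open>v\<close> and \<open>u\<close> and \<open>\<alpha> = d(v, w) - \<pi>\<close>; otherwise it holds because no angle exceeds \<open>\<pi>\<close>.\<close>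

lemma geodesic_triangle:
  assumes u: "L2_set u {..<d} = 1" and v: "L2_set v {..<d} = 1" and w: "L2_set w {..<d} = 1"
  shows "geodesic_dist d u w \<le> geodesic_dist d u v + geodesic_dist d v w"
proof (cases "geodesic_dist d u v + geodesic_dist d v w \<le> pi")
  case True
  let ?\<alpha> = "geodesic_dist d v w - pi"
  have 1: "\<bar>dot d y z\<bar> \<le> 1" if "L2_set y {..<d} = 1" "L2_set z {..<d} = 1" for y z
    using abs_dot_le_1[of y d z] that by simp
  have neg: "dot d (\<lambda>i. - w i) y = - dot d w y" for y
    by (simp add: dot_def sum_negf)
  have range: "0 \<le> geodesic_dist d y z" "cos (geodesic_dist d y z) = dot d y z"
    if "L2_set y {..<d} = 1" "L2_set z {..<d} = 1" for y z
    using 1[OF that] by (auto simp: geodesic_dist_def intro: arccos_lbound)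
  have "dot d (\<lambda>i. - w i) u \<le> cos (?\<alpha> + geodesic_dist d v u)"
  proof (rule dot_le_geodesic)
    show "L2_set (\<lambda>i. - w i) {..<d} \<le> 1" using w by (simp add: L2_set_def)
    show "-pi \<le> ?\<alpha>" using range(1)[OF v w] by simp
    show "?\<alpha> + geodesic_dist d v u \<le> 0"
      using True by (simp add: geodesic_dist_def dot_commute[of d v u])
    show "dot d (\<lambda>i. - w i) v \<le> cos ?\<alpha>"
      using range(2)[OF v w] by (simp add: neg dot_commute[of d w v] cos_diff)
  qed (use u v in auto)
  then have "cos (geodesic_dist d v w + geodesic_dist d v u) \<le> dot d u w"
    using cos_minus_pi[of "geodesic_dist d v w + geodesic_dist d v u"]
    by (simp add: neg dot_commute[of d w u] algebra_simps)
  then have "cos (geodesic_dist d u v + geodesic_dist d v w) \<le> cos (geodesic_dist d u w)"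
    using range(2)[OF u w] by (simp add: geodesic_dist_def dot_commute[of d v u] add.commute)
  then show ?thesis
    using True range(1)[OF u v] range(1)[OF v w] range(1)[OF u w] 1[OF u w]
      arccos_ubound[of "dot d u w"]
    by (subst (asm) cos_mono_le_eq) (auto simp: geodesic_dist_def)
next
  case False
  then show ?thesis
    using abs_dot_le_1[of u d w] u w arccos_ubound[of "dot d u w"] unfolding geodesic_dist_def by linarith
qed

lemma unit_sphereD: "v \<in> unit_sphere d \<Longrightarrow> L2_set v {..<d} = 1"
  by (simp add: unit_sphere_def)

lemma sphere_dist_triangle:
  assumes "u \<in> unit_sphere d" "v \<in> unit_sphere d" "w \<in> unit_sphere d"
  shows "sphere_dist s d u w \<le> sphere_dist s d u v + sphere_dist s d v w"
proof (cases s)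
  case Height
  have "chordal_dist d u w = L2_set (\<lambda>i. (u i - v i) + (v i - w i)) {..<d}"
    by (simp add: chordal_dist_def)
  also have "\<dots> \<le> chordal_dist d u v + chordal_dist d v w"
    unfolding chordal_dist_def by (rule L2_set_triangle_ineq)
  finally show ?thesis by (simp add: Height)
next
  case Angle
  then show ?thesis using assms by (simp add: geodesic_triangle unit_sphereD)
qed

lemma sphere_dist_commute: "sphere_dist s d v w = sphere_dist s d w v"
  by (cases s)
    (simp_all add: chordal_dist_def geodesic_dist_def L2_set_def power2_commute dot_commute[of d v w])

lemma sphere_dist_nonneg:
  "v \<in> unit_sphere d \<Longrightarrow> w \<in> unit_sphere d \<Longrightarrow> 0 \<le> sphere_dist s d v w"
  using abs_dot_le_1[of v d w]
  by (cases s) (auto simp: chordal_dist_def geodesic_dist_def unit_sphereD intro!: arccos_lbound)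

lemma sphere_dist_self: "v \<in> unit_sphere d \<Longrightarrow> sphere_dist s d v v = 0"
  by (cases s) (simp_all add: chordal_dist_def geodesic_dist_def dot_self unit_sphereD L2_set_0')

lemma Sup_interval: "x \<in> interval s \<Longrightarrow> x \<le> Sup (interval s)"
  "threshold s (Sup (interval s)) = 1"
  by (cases s; simp)+

lemma shift_interval:
  "0 \<le> \<epsilon> \<Longrightarrow> x \<in> interval s \<Longrightarrow> time_shift (interval s) \<epsilon> x \<in> interval s"
  by (cases s) (auto simp: time_shift_def min_def)

text \<open>A morphism of the space-time category induces an inclusion of sublevel sets. At the top of the
  interval the threshold is \<open>1\<close>, which no point of the unit disk exceeds in any direction.\<close>

lemma dot_le_threshold:
  assumes x: "x \<in> unit_disk d" and v: "v \<in> unit_sphere d" and w: "w \<in> unit_sphere d"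
    and \<alpha>: "\<alpha> \<in> interval s" and \<beta>: "\<beta> \<in> interval s"
    and rel: "spacetime_le s d (v, \<alpha>) (w, \<beta>)" and le: "dot d x v \<le> threshold s \<alpha>"
  shows "dot d x w \<le> threshold s \<beta>"
proof (cases "\<beta> = Sup (interval s)")
  case True
  then show ?thesis
    using abs_dot_le_1[of x d w] x w by (simp add: Sup_interval unit_disk_def unit_sphere_def)
next
  case False
  then have rel: "\<alpha> + sphere_dist s d v w \<le> \<beta>" using rel by (simp add: spacetime_le_def)
  have x1: "L2_set x {..<d} \<le> 1" using x by (simp add: unit_disk_def)
  show ?thesis
  proof (cases s)
    case Height
    have "dot d x w - dot d x v = dot d x (\<lambda>i. w i - v i)" by (simp add: dot_diff_right)
    also have "\<dots> \<le> L2_set x {..<d} * L2_set (\<lambda>i. w i - v i) {..<d}"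
      using abs_dot_le[of d x "\<lambda>i. w i - v i"] by simp
    also have "\<dots> \<le> L2_set (\<lambda>i. w i - v i) {..<d}" using x1 by (simp add: mult_left_le_one_le)
    also have "\<dots> = sphere_dist s d v w"
      by (subst sphere_dist_commute) (simp add: Height chordal_dist_def)
    finally show ?thesis using rel le by (simp add: Height)
  next
    case Angle
    let ?g = "geodesic_dist d v w"
    have r: "\<alpha> + ?g \<le> \<beta>" "-pi \<le> \<alpha>" "\<beta> \<le> 0" "0 \<le> ?g"
      using rel \<alpha> \<beta> sphere_dist_nonneg[OF v w, of Angle] by (simp_all add: Angle)
    have "dot d x w \<le> cos (\<alpha> + ?g)"
      using x1 v w r le by (intro dot_le_geodesic) (auto simp: unit_sphereD Angle)
    also have "\<dots> = cos (- (\<alpha> + ?g))" by (rule cos_minus[symmetric])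
    also have "\<dots> \<le> cos (- \<beta>)" using r by (intro cos_monotone_0_pi_le) auto
    finally show ?thesis by (simp add: Angle)
  qed
qed

text \<open>The triangle inequality, except when an endpoint is at the top of the interval. If the middle time
  is at the top and the last one is reached by a distance bound, then the last time is at the top as well.\<close>

lemma spacetime_le_trans:
  assumes "v \<in> unit_sphere d" "w \<in> unit_sphere d" "u \<in> unit_sphere d" "\<gamma> \<in> interval s"
    and "spacetime_le s d (v, \<alpha>) (w, \<beta>)" "spacetime_le s d (w, \<beta>) (u, \<gamma>)"
  shows "spacetime_le s d (v, \<alpha>) (u, \<gamma>)"
  using assms sphere_dist_triangle[OF assms(1,2,3), of s] sphere_dist_nonneg[OF assms(2,3), of s]
    Sup_interval(1)[OF assms(4)]
  by (auto simp: spacetime_le_def)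

text \<open>Truncating the target time at the top of the interval loses no morphism: the objects at the top are
  terminal.\<close>

lemma spacetime_le_shift:
  assumes "\<alpha> + sphere_dist s d v w \<le> \<beta>"
  shows "spacetime_le s d (v, \<alpha>) (w, min \<beta> (Sup (interval s)))"
  using assms by (auto simp: spacetime_le_def min_def)

section \<open>The persistent homology transform\<close>

lemma spacetime_commuting_diagram:
  assumes "cring k" and M: "M \<subseteq> unit_disk d"
  shows "commuting_diagram k (unit_sphere d \<times> interval s) (spacetime_le s d)
    (spacetime_diagram k s d n M)"
proof -
  interpret cring k by fact
  let ?X = "\<lambda>p. sublevel s d M (fst p) (snd p)"
  have G: "obj (spacetime_diagram k s d n M) p = homology_module k n (?X p)"
    "arr (spacetime_diagram k s d n M) p' p = homology_inclusion k n (?X p)" for p p'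
    by (simp_all add: spacetime_diagram_def PHT_def case_prod_beta)
  have simplices: "singular_simplex_set r (?X p) \<subseteq> singular_simplex_set r (?X p')"
    if "p \<in> unit_sphere d \<times> interval s" "p' \<in> unit_sphere d \<times> interval s" "spacetime_le s d p p'"
    for r p p'
  proof -
    have "{x \<in> M. dot d x (fst p) \<le> threshold s (snd p)} \<subseteq> {x \<in> M. dot d x (fst p') \<le> threshold s (snd p')}"
      using that M dot_le_threshold[of _ d "fst p" "fst p'" "snd p" s "snd p'"] by auto
    then show ?thesis unfolding sublevel_def by (blast intro: singular_simplex_mono)
  qed
  show ?thesis
  proof (rule commuting_diagram.intro)
    show "spacetime_le s d i l"
      if "i \<in> unit_sphere d \<times> interval s" "j \<in> unit_sphere d \<times> interval s"
        "l \<in> unit_sphere d \<times> interval s" "spacetime_le s d i j" "spacetime_le s d j l" for i j l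
      using that spacetime_le_trans by (cases i; cases j; cases l) blast
  qed (simp_all add: G assms(1) homology_module_module homology_inclusion_linear
      homology_inclusion_comp[OF simplices simplices] simplices)
qed

lemma PHT_eq_slice: "PHT k s d n M = slice (spacetime_diagram k s d n M)"
  by (simp add: fun_eq_iff PHT_def slice_def spacetime_diagram_def)

text \<open>A direction \<open>v\<close> in \<open>A\<close> at distance \<open>\<delta>\<close> from \<open>w\<close> is at most \<open>\<delta>\<close> late: waiting for the time \<open>\<delta>\<close> leads from
  \<open>w\<close> to \<open>v\<close>, and waiting once more leads back to \<open>w\<close>. The two waits are the factor \<open>2\<close> of the bound.\<close>

lemma PHT_sampled_slice:
  assumes "cring k" and M: "M \<subseteq> unit_disk d" and A: "A \<subseteq> unit_sphere d"
    and w: "w \<in> unit_sphere d" and v: "v \<in> A"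
  shows "sampled_slice k (unit_sphere d \<times> interval s) (spacetime_le s d)
    (spacetime_diagram k s d n M) (A \<times> interval s) (interval s) (2 * sphere_dist s d v w) w
    (\<lambda>x. (v, time_shift (interval s) (sphere_dist s d v w) x))"
proof -
  let ?\<delta> = "sphere_dist s d v w"
  have vS: "v \<in> unit_sphere d" using v A by blast
  have \<delta>: "0 \<le> ?\<delta>" by (rule sphere_dist_nonneg[OF vS w])
  note comm = sphere_dist_commute[of s d w v]
  have self: "sphere_dist s d v v = 0" "sphere_dist s d w w = 0"
    using vS w by (auto intro: sphere_dist_self)
  show ?thesis
  proof (intro sampled_slice.intro sampled_slice_axioms.intro spacetime_commuting_diagram[OF assms(1) M])
    fix x assume x: "x \<in> interval s"
    show "time_shift (interval s) (2 * ?\<delta>) x \<in> interval s" using x \<delta> by (simp add: shift_interval)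
    show "(w, x) \<in> unit_sphere d \<times> interval s" using w x by simp
    show "(v, time_shift (interval s) ?\<delta> x) \<in> A \<times> interval s" using v x \<delta> by (simp add: shift_interval)
    show "spacetime_le s d (w, x) (v, time_shift (interval s) ?\<delta> x)"
      unfolding time_shift_def by (rule spacetime_le_shift) (simp add: comm)
    show "spacetime_le s d (v, time_shift (interval s) ?\<delta> x) (w, time_shift (interval s) (2 * ?\<delta>) x)"
      unfolding time_shift_twice[OF \<delta>] by (subst (2) time_shift_def) (rule spacetime_le_shift, simp)
  next
    fix x y assume xy: "x \<in> interval s" "y \<in> interval s" "x \<le> y"
    show "spacetime_le s d (w, x) (w, y)" using xy by (simp add: spacetime_le_def self)
    show "spacetime_le s d (v, time_shift (interval s) ?\<delta> x) (v, time_shift (interval s) ?\<delta> y)"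
      using time_shift_mono[OF xy(3)] by (simp add: spacetime_le_def self)
  qed (use A \<delta> in auto)
qed

text \<open>The infimum over \<open>A\<close> need not be attained, so the bounds for the single \<open>v\<close> are halved before they
  are collected. An empty \<open>A\<close> gives an infinite infimum, or no \<open>w\<close> at all when the sphere is empty.\<close>

lemma d_I_le:
  assumes "\<And>v w. v \<in> A \<Longrightarrow> w \<in> unit_sphere d \<Longrightarrow>
      d_Int k (interval s) (F w) (F' w) \<le> ennreal (2 * sphere_dist s d v w)"
    and A: "A \<subseteq> unit_sphere d"
  shows "d_I k s d F F' \<le> 2 * d_H s d A"
  unfolding d_I_def
proof (rule SUP_least)
  fix w assume w: "w \<in> unit_sphere d"
  let ?D = "d_Int k (interval s) (F w) (F' w)"
  have "?D / 2 \<le> (INF v\<in>A. ennreal (sphere_dist s d v w))"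
  proof (rule INF_greatest)
    fix v assume v: "v \<in> A"
    have "?D \<le> 2 * ennreal (sphere_dist s d v w)"
      using assms(1)[OF v w] v A w by (auto simp: ennreal_mult sphere_dist_nonneg subset_iff)
    then show "?D / 2 \<le> ennreal (sphere_dist s d v w)"
      by (intro divide_le_posI_ennreal) auto
  qed
  also have "\<dots> \<le> d_H s d A" unfolding d_H_def by (rule SUP_upper[OF w])
  finally have "2 * (?D / 2) \<le> 2 * d_H s d A" by (rule mult_left_mono) simp
  then show "?D \<le> 2 * d_H s d A" by (simp add: ennreal_times_divide mult.commute[of 2] mult_divide_eq_ennreal)
qed

theorem theorem4p6:
  fixes k :: "('k, 'r) ring_scheme"
    and \<O> :: "nat \<Rightarrow> (nat \<Rightarrow> real) set set"
    and d n :: nat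
    and s :: setting
    and M A :: "(nat \<Rightarrow> real) set"
  assumes "field k"
    and "o_minimal_structure \<O>"
    and "constructible \<O> d M"
    and "M \<subseteq> unit_disk d"
    and "A \<subseteq> unit_sphere d"
  shows "d_I k s d (PHT k s d n M) (PHT_left k s d n M A) \<le> 2 * d_H s d A
       \<and> d_I k s d (PHT k s d n M) (PHT_right k s d n M A) \<le> 2 * d_H s d A
       \<and> d_I k s d (PHT k s d n M) (PHT_center k s d n M A) \<le> 2 * d_H s d A"
proof -
  have "cring k" using assms(1) by (simp add: field_def domain_def)
  note slice = PHT_sampled_slice[OF this assms(4,5), where n = n and s = s]
  note le = sampled_slice.d_Int_kan_le[OF slice]
  show ?thesis
    unfolding PHT_left_def PHT_right_def PHT_center_def PHT_eq_slice
    by (intro conjI d_I_le le assms(5))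
qed

end
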